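(* Let $\widetilde{\mathfrak{P}}_\mathfrak{B} \in \mathcal{W}^+(A)$ be of the form \[ \widetilde{\mathfrak{P}}_\mathfrak{B}(X_1,X_2;Y_1,Y_2) = -\tfrac{1}{2}\Big( \big(\tfrac{1}{X_2} + \tfrac{1}{Y_2} \big) \mathfrak{B}_1(X_1;Y_1) + \big(\tfrac{1}{X_1} + \tfrac{1}{Y_1} \big) \mathfrak{B}_1(X_2;Y_2) \Big) + \mathfrak{P}_\mathfrak{B}(X_1,X_2;Y_1,Y_2), \] for some $\mathfrak{B}_1(X_1;Y_1)\in A[[X_1,Y_1]]$, $\mathfrak{P}_\mathfrak{B}\in A[[X_1,X_2,Y_1,Y_2]]$ with $\mathfrak{B}_1(-X_1;-Y_1)=-\mathfrak{B}_1(X_1;Y_1)$. Then \[ \mathfrak{B}_2 :=\tfrac{1}{3} \mathfrak{P}_\mathfrak{B} \mid (1+T^{-1})-\tfrac{1}{12} \mathfrak{R}_{\mathfrak{B}_1}^\ast \mid (5 -3 U + U \epsilon) -\tfrac{1}{12}\mathfrak{R}_{\mathfrak{B}_1}^{\sqcup\!\sqcup} \mid (T^{-1} ( 5 - 3 \epsilon + U))\] satisfies \[ \mathfrak{P}_\mathfrak{B} = \mathfrak{B}_2 \mid (1+\epsilon) + \mathfrak{R}_{\mathfrak{B}_1}^\ast = \mathfrak{B}_2 \mid T(1+\epsilon) + \mathfrak{R}_{\mathfrak{B}_1}^{\sqcup\!\sqcup}. \] In particular, one obtains a realization (a $\mathbb{Q}$-linear map) $\mathcal{E}_k\to A$ for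 every $k\geq 1$, sending $G\left(\begin{smallmatrix}k\\d\end{smallmatrix}\right)$, $G\left(\begin{smallmatrix}k_1,k_2\\d_1,d_2\end{smallmatrix}\right)$, $P\left(\begin{smallmatrix}k_1,k_2\\d_1,d_2\end{smallmatrix}\right)$ to the coefficients of $X^{k-1}\frac{Y^d}{d!}$ in $\mathfrak{B}_1$, resp. of $X_1^{k_1-1}X_2^{k_2-1}\frac{Y_1^{d_1}}{d_1!}\frac{Y_2^{d_2}}{d_2!}$ in $\mathfrak{B}_2$, resp. in $\mathfrak{P}_\mathfrak{B}$.
   Context: Let $A$ be a $\mathbb{Q}$-algebra; write power series as $R(X_1,X_2;Y_1,Y_2)$. For $\gamma=\begin{pmatrix}a&b\\c&d\end{pmatrix}\in\operatorname{GL}_2(\mathbb Z)$ set $(R\mid\gamma)(X_1,X_2;Y_1,Y_2):=R(aX_1+bX_2,\,cX_1+dX_2;\,\det(\gamma)(dY_1-cY_2),\,\det(\gamma)(-bY_1+aY_2))$, extended $\mathbb Z$-linearly to $\mathbb Z[\operatorname{GL}_2(\mathbb Z)]$ (for Laurent series, identities are read in the field of fractions). Let $\epsilon=\begin{pmatrix}0&1\\1&0\end{pmatrix}$, $T=\begin{pmatrix}1&1\\0&1\end{pmatrix}$, $S=\begin{pmatrix}0&-1\\1&0\end{pmatrix}$, $U=\begin{pmatrix}1&-1\\1&0\end{pmatrix}$. $\mathcal{W}^+(A)$ is the set of Laurent series $R\in A((X_1,X_2,Y_1,Y_2))$ with $R\mid(1+U+U^2)=R\mid(1+S)=R\mid(1-\epsilon)=0$.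 For $\mathfrak{T}(X;Y)\in A[[X,Y]]$: $\mathfrak{R}^\ast_{\mathfrak{T}}:=\frac{\mathfrak{T}(X_1;Y_1+Y_2)-\mathfrak{T}(X_2;Y_1+Y_2)}{X_1-X_2}$, $\mathfrak{R}^{\sqcup\!\sqcup}_{\mathfrak{T}}:=\frac{\mathfrak{T}(X_1+X_2;Y_1)-\mathfrak{T}(X_1+X_2;Y_2)}{Y_1-Y_2}$. The formal double Eisenstein space $\mathcal{E}_K$ ($K\ge1$) is the $\mathbb{Q}$-vector space spanned by symbols $G\left(\begin{smallmatrix}k\\d\end{smallmatrix}\right)$, $G\left(\begin{smallmatrix}k_1,k_2\\d_1,d_2\end{smallmatrix}\right)$, $P\left(\begin{smallmatrix}k_1,k_2\\d_1,d_2\end{smallmatrix}\right)$ with $k,k_i\ge1$, $d,d_i\ge0$, $k+d=k_1+k_2+d_1+d_2=K$, modulo the relations obtained by comparing coefficients in $\mathfrak{P}=\mathfrak{G}_2\mid(1+\epsilon)+\mathfrak{R}^\ast_{\mathfrak{G}_1}=\mathfrak{G}_2\mid T(1+\epsilon)+\mathfrak{R}^{\sqcup\!\sqcup}_{\mathfrak{G}_1}$, where $\mathfrak{G}_1(X;Y)=\sum G\left(\begin{smallmatrix}k\\d\end{smallmatrix}\right)X^{k-1}\frac{Y^d}{d!}$, $\mathfrak{G}_2=\sum G\left(\begin{smallmatrix}k_1,k_2\\d_1,d_2\end{smallmatrix}\right)X_1^{k_1-1}X_2^{k_2-1}\frac{Y_1^{d_1}}{d_1!}\frac{Y_2^{d_2}}{d_2!}$,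 and $\mathfrak{P}$ likewise with $P$. *)

theory Defs
  imports
    "HOL-Analysis.Determinants"
    "HOL-Computational_Algebra.Formal_Power_Series"
    "HOL-Library.Poly_Mapping"
begin

class rat_algebra = comm_ring_1 +
  fixes scaleQ :: "rat \<Rightarrow> 'a \<Rightarrow> 'a"  (infixr \<open>*\<^sub>Q\<close> 75)
  assumes scaleQ_add_right: "c *\<^sub>Q (x + y) = c *\<^sub>Q x + c *\<^sub>Q y"
    and scaleQ_add_left: "(b + c) *\<^sub>Q x = b *\<^sub>Q x + c *\<^sub>Q x"
    and scaleQ_scaleQ: "b *\<^sub>Q (c *\<^sub>Q x) = (b * c) *\<^sub>Q x"
    and scaleQ_one: "1 *\<^sub>Q x = x"
    and mult_scaleQ_left: "(c *\<^sub>Q x) * y = c *\<^sub>Q (x * y)"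

lemma scaleQ_mult_one: "(b * c) *\<^sub>Q (1 :: 'a :: rat_algebra) = (b *\<^sub>Q 1) * (c *\<^sub>Q 1)"
  by (simp add: mult_scaleQ_left scaleQ_scaleQ)

instantiation rat :: rat_algebra
begin
definition scaleQ_rat :: "rat \<Rightarrow> rat \<Rightarrow> rat" where "scaleQ_rat c x = c * x"
instance by standard (simp_all add: scaleQ_rat_def algebra_simps)
end

instantiation fps :: (rat_algebra) rat_algebra
begin
definition scaleQ_fps :: "rat \<Rightarrow> 'a fps \<Rightarrow> 'a fps"
  where "c *\<^sub>Q f = fps_const (c *\<^sub>Q 1) * f"
instance
proof
  fix b c :: rat and x y :: "'a fps"
  show "c *\<^sub>Q (x + y) = c *\<^sub>Q x + c *\<^sub>Q y"
    by (simp only: scaleQ_fps_def distrib_left)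
  show "(c *\<^sub>Q x) * y = c *\<^sub>Q (x * y)"
    by (simp only: scaleQ_fps_def mult.assoc)
  have "fps_const ((b + c) *\<^sub>Q (1 :: 'a)) = fps_const (b *\<^sub>Q 1) + fps_const (c *\<^sub>Q 1)"
    by (simp only: scaleQ_add_left fps_const_add)
  thus "(b + c) *\<^sub>Q x = b *\<^sub>Q x + c *\<^sub>Q x"
    by (simp only: scaleQ_fps_def distrib_right)
  have "fps_const ((b * c) *\<^sub>Q (1 :: 'a)) = fps_const (b *\<^sub>Q 1) * fps_const (c *\<^sub>Q 1)"
    by (simp only: scaleQ_mult_one fps_const_mult)
  thus "b *\<^sub>Q (c *\<^sub>Q x) = (b * c) *\<^sub>Q x"
    by (simp only: scaleQ_fps_def mult.assoc)
  show "1 *\<^sub>Q x = x"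
    by (simp only: scaleQ_fps_def scaleQ_one fps_const_1_eq_1 mult_1_left)
qed
end

instantiation poly_mapping :: (comm_monoid_add, rat_algebra) rat_algebra
begin
definition scaleQ_poly_mapping :: "rat \<Rightarrow> ('a \<Rightarrow>\<^sub>0 'b) \<Rightarrow> ('a \<Rightarrow>\<^sub>0 'b)"
  where "c *\<^sub>Q p = Poly_Mapping.single 0 (c *\<^sub>Q 1) * p"
instance
proof
  fix b c :: rat and x y :: "'a \<Rightarrow>\<^sub>0 'b"
  show "b *\<^sub>Q (c *\<^sub>Q x) = (b * c) *\<^sub>Q x"
    by (simp add: scaleQ_poly_mapping_def scaleQ_mult_one mult_single flip: mult.assoc)
  show "1 *\<^sub>Q x = x"
    by (simp add: scaleQ_poly_mapping_def scaleQ_one)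
  show "c *\<^sub>Q (x + y) = c *\<^sub>Q x + c *\<^sub>Q y" "(c *\<^sub>Q x) * y = c *\<^sub>Q (x * y)"
    by (simp_all only: scaleQ_poly_mapping_def distrib_left mult.assoc)
  show "(b + c) *\<^sub>Q x = b *\<^sub>Q x + c *\<^sub>Q x"
    by (simp only: scaleQ_poly_mapping_def scaleQ_add_left single_add distrib_right)
qed
end

text \<open>
  Fractions are formed in the total ring of fractions (denominators: all non-zero-divisors),
  which is the field of fractions if the ring is a domain. The coefficient algebra need not be
  a domain, and a commutative ring always embeds into its total ring of fractions.
\<close>

definition regular :: "'a :: comm_ring_1 \<Rightarrow> bool"
  where "regular b \<longleftrightarrow> (\<forall>x. b * x = 0 \<longrightarrow> x = 0)"

lemma regular_one [simp]: "regular 1"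
  by (simp add: regular_def)

lemma regular_mult [intro]: "regular a \<Longrightarrow> regular b \<Longrightarrow> regular (a * b)"
  unfolding regular_def mult.assoc by blast

lemma regular_cancel:
  assumes "regular b" "b * x = b * y"
  shows "x = y"
proof -
  have "b * (x - y) = 0" using assms(2) by (simp add: right_diff_distrib)
  with assms(1) have "x - y = 0" unfolding regular_def by blast
  thus ?thesis by simp
qed

definition frac_rel :: "'a :: comm_ring_1 \<times> 'a \<Rightarrow> 'a \<times> 'a \<Rightarrow> bool"
  where "frac_rel = (\<lambda>(a, b) (c, d). regular b \<and> regular d \<and> a * d = c * b)"

lemma frac_rel_trans:
  assumes "frac_rel p q" "frac_rel q r"
  shows "frac_rel p r"
proof -
  obtain a b c d e f where [simp]: "p = (a, b)" "q = (c, d)" "r = (e, f)"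
    by (metis surj_pair)
  have r: "regular b" "regular d" "regular f" and e: "a * d = c * b" "c * f = e * d"
    using assms by (auto simp: frac_rel_def)
  have "d * (a * f) = (a * d) * f" by (simp only: ac_simps)
  also have "\<dots> = (c * b) * f" by (simp only: e(1))
  also have "\<dots> = (c * f) * b" by (simp only: ac_simps)
  also have "\<dots> = (e * d) * b" by (simp only: e(2))
  also have "\<dots> = d * (e * b)" by (simp only: ac_simps)
  finally have "a * f = e * b" using regular_cancel r(2) by blast
  thus ?thesis using r by (simp add: frac_rel_def)
qed

quotient_type (overloaded) 'a total_fract = "'a :: comm_ring_1 \<times> 'a" / partial: frac_rel
proof (rule part_equivpI)
  show "\<exists>x :: 'a \<times> 'a. frac_rel x x"
    by (rule exI[of _ "(0, 1)"]) (simp add: frac_rel_def)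
  show "symp (frac_rel :: 'a \<times> 'a \<Rightarrow> _)"
    by (auto simp: symp_def frac_rel_def)
  show "transp (frac_rel :: 'a \<times> 'a \<Rightarrow> _)"
    unfolding transp_def using frac_rel_trans by blast
qed

text \<open>The fraction \<open>a / b\<close>; the value for non-regular \<open>b\<close> is a dummy.\<close>

lift_definition tfrac :: "'a :: comm_ring_1 \<Rightarrow> 'a \<Rightarrow> 'a total_fract"
  is "\<lambda>a b. if regular b then (a, b) else (0, 1)"
  by (simp add: frac_rel_def)

lemma tfrac_eq_iff:
  "regular b \<Longrightarrow> regular d \<Longrightarrow> tfrac a b = tfrac c d \<longleftrightarrow> a * d = c * b"
  by transfer (simp add: frac_rel_def)

lemma total_fract_cases:
  obtains a b where "regular b" "q = tfrac a b"
proof -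
  have "\<exists>a b. regular b \<and> q = tfrac a b"
    by transfer (auto simp: frac_rel_def)
  thus ?thesis using that by blast
qed

instantiation total_fract :: (comm_ring_1) comm_ring_1
begin

lift_definition zero_total_fract :: "'a total_fract" is "(0, 1)"
  by (simp add: frac_rel_def)

lift_definition one_total_fract :: "'a total_fract" is "(1, 1)"
  by (simp add: frac_rel_def)

lift_definition uminus_total_fract :: "'a total_fract \<Rightarrow> 'a total_fract"
  is "\<lambda>(a, b). (- a, b)"
  by (auto simp: frac_rel_def)

lift_definition times_total_fract :: "'a total_fract \<Rightarrow> 'a total_fract \<Rightarrow> 'a total_fract"
  is "\<lambda>(a, b) (c, d). (a * c, b * d)"
proof (clarsimp simp: frac_rel_def, intro conjI regular_mult; assumption?)
  fix a b a' b' c d c' d' :: 'a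
  assume "a * b' = a' * b" "c * d' = c' * d"
  hence "(a * b') * (c * d') = (a' * b) * (c' * d)" by simp
  thus "a * c * (b' * d') = a' * c' * (b * d)" by (simp add: ac_simps)
qed

lift_definition plus_total_fract :: "'a total_fract \<Rightarrow> 'a total_fract \<Rightarrow> 'a total_fract"
  is "\<lambda>(a, b) (c, d). (a * d + c * b, b * d)"
proof (clarsimp simp: frac_rel_def, intro conjI regular_mult; assumption?)
  fix a b a' b' c d c' d' :: 'a
  assume e: "a * b' = a' * b" "c * d' = c' * d"
  have "(a * d + c * b) * (b' * d') = (a * b') * (d * d') + (c * d') * (b * b')"
    by (simp add: algebra_simps)
  also have "\<dots> = (a' * b) * (d * d') + (c' * d) * (b * b')"
    by (simp only: e)
  also have "\<dots> = (a' * d' + c' * b') * (b * d)"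
    by (simp add: algebra_simps)
  finally show "(a * d + c * b) * (b' * d') = (a' * d' + c' * b') * (b * d)" .
qed

definition minus_total_fract :: "'a total_fract \<Rightarrow> 'a total_fract \<Rightarrow> 'a total_fract"
  where "x - y = x + - (y :: 'a total_fract)"

lemma tfrac_mult:
  "regular b \<Longrightarrow> regular d \<Longrightarrow> tfrac a b * tfrac c d = tfrac (a * c) (b * (d :: 'a))"
  by transfer (auto simp: frac_rel_def)

lemma tfrac_add:
  "regular b \<Longrightarrow> regular d \<Longrightarrow> tfrac a b + tfrac c d = tfrac (a * d + c * b) (b * (d :: 'a))"
  by transfer (auto simp: frac_rel_def)

lemma tfrac_uminus: "regular b \<Longrightarrow> - tfrac a b = tfrac (- a) (b :: 'a)"
  by transfer (simp add: frac_rel_def)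

lemma tfrac_zero: "0 = tfrac 0 (1 :: 'a)"
  by transfer (simp add: frac_rel_def)

lemma tfrac_one: "1 = tfrac 1 (1 :: 'a)"
  by transfer (simp add: frac_rel_def)

instance
proof
  fix x y z :: "'a total_fract"
  obtain a b where b: "regular b" and x: "x = tfrac a b" by (rule total_fract_cases)
  obtain c d where d: "regular d" and y: "y = tfrac c d" by (rule total_fract_cases)
  obtain e f where f: "regular f" and z: "z = tfrac e f" by (rule total_fract_cases)
  note [simp] = b d f regular_mult tfrac_mult tfrac_add tfrac_uminus tfrac_eq_iff
  show "x * y * z = x * (y * z)" by (simp add: x y z mult.assoc)
  show "x * y = y * x" by (simp add: x y ac_simps)
  show "1 * x = x" by (simp add: x tfrac_one)
  show "x + y + z = x + (y + z)" by (simp add: x y z algebra_simps)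
  show "x + y = y + x" by (simp add: x y algebra_simps)
  show "0 + x = x" by (simp add: x tfrac_zero)
  show "- x + x = 0" by (simp add: x tfrac_zero)
  show "x - y = x + - y" by (simp add: minus_total_fract_def)
  show "(x + y) * z = x * z + y * z" by (simp add: x y z algebra_simps)
  show "(0 :: 'a total_fract) \<noteq> 1" by (simp add: tfrac_zero tfrac_one)
qed

end

instantiation total_fract :: (rat_algebra) rat_algebra
begin
definition scaleQ_total_fract :: "rat \<Rightarrow> 'a total_fract \<Rightarrow> 'a total_fract"
  where "c *\<^sub>Q q = tfrac (c *\<^sub>Q 1) 1 * q"
instance
proof
  fix b c :: rat and x y :: "'a total_fract"
  show "(b + c) *\<^sub>Q x = b *\<^sub>Q x + c *\<^sub>Q x"
    unfolding scaleQ_total_fract_def scaleQ_add_left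
    by (simp add: tfrac_add flip: distrib_right)
  show "b *\<^sub>Q (c *\<^sub>Q x) = (b * c) *\<^sub>Q x"
    unfolding scaleQ_total_fract_def scaleQ_mult_one
    by (simp add: tfrac_mult flip: mult.assoc)
  show "1 *\<^sub>Q x = x"
    by (simp add: scaleQ_total_fract_def scaleQ_one flip: tfrac_one)
  show "c *\<^sub>Q (x + y) = c *\<^sub>Q x + c *\<^sub>Q y" "(c *\<^sub>Q x) * y = c *\<^sub>Q (x * y)"
    by (simp_all only: scaleQ_total_fract_def distrib_left mult.assoc)
qed
end

text \<open>
  \<open>A[[X, Y]]\<close> is \<open>A[[X]][[Y]]\<close> and \<open>A[[X\<^sub>1, X\<^sub>2, Y\<^sub>1, Y\<^sub>2]]\<close> is \<open>A[[X\<^sub>1]][[X\<^sub>2]][[Y\<^sub>1]][[Y\<^sub>2]]\<close>, so the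
  outermost type constructor belongs to the last variable.
\<close>

type_synonym 'a ps2 = "'a fps fps"
type_synonym 'a ps4 = "'a fps fps fps fps"

definition coeff2 :: "'a ps2 \<Rightarrow> nat \<Rightarrow> nat \<Rightarrow> 'a"
  where "coeff2 F i j = fps_nth (fps_nth F j) i"

definition coeff4 :: "'a ps4 \<Rightarrow> nat \<Rightarrow> nat \<Rightarrow> nat \<Rightarrow> nat \<Rightarrow> 'a"
  where "coeff4 F i j k l = fps_nth (fps_nth (fps_nth (fps_nth F l) k) j) i"

definition mk_ps2 :: "(nat \<Rightarrow> nat \<Rightarrow> 'a) \<Rightarrow> 'a ps2"
  where "mk_ps2 c = Abs_fps (\<lambda>j. Abs_fps (\<lambda>i. c i j))"

definition mk_ps4 :: "(nat \<Rightarrow> nat \<Rightarrow> nat \<Rightarrow> nat \<Rightarrow> 'a) \<Rightarrow> 'a ps4"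
  where "mk_ps4 c = Abs_fps (\<lambda>l. Abs_fps (\<lambda>k. Abs_fps (\<lambda>j. Abs_fps (\<lambda>i. c i j k l))))"

lemma coeff2_mk_ps2 [simp]: "coeff2 (mk_ps2 c) i j = c i j"
  by (simp add: coeff2_def mk_ps2_def)

lemma coeff4_mk_ps4 [simp]: "coeff4 (mk_ps4 c) i j k l = c i j k l"
  by (simp add: coeff4_def mk_ps4_def)

definition X1 :: "'a :: comm_ring_1 ps4" where "X1 = fps_const (fps_const (fps_const fps_X))"
definition X2 :: "'a :: comm_ring_1 ps4" where "X2 = fps_const (fps_const fps_X)"
definition Y1 :: "'a :: comm_ring_1 ps4" where "Y1 = fps_const fps_X"
definition Y2 :: "'a :: comm_ring_1 ps4" where "Y2 = fps_X"

text \<open>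
  Substitution of four-variable series \<open>f, g, \<dots>\<close> \<^emph>\<open>without constant term\<close>. The coefficient of a
  monomial of total degree \<open>n\<close> in \<open>f^p * g^q * \<dots>\<close> then vanishes unless \<open>p + q + \<dots> \<le> n\<close>, so the
  infinite sum defining the substitution may be cut off at exponents \<open>\<le> n\<close>, coefficient by
  coefficient.
\<close>

definition subst2 :: "'a :: comm_ring_1 ps2 \<Rightarrow> 'a ps4 \<Rightarrow> 'a ps4 \<Rightarrow> 'a ps4"
  where "subst2 F f g = mk_ps4 (\<lambda>i j k l. let n = i + j + k + l in
    \<Sum>p\<le>n. \<Sum>q\<le>n. coeff2 F p q * coeff4 (f ^ p * g ^ q) i j k l)"

definition subst4 ::
    "'a :: comm_ring_1 ps4 \<Rightarrow> 'a ps4 \<Rightarrow> 'a ps4 \<Rightarrow> 'a ps4 \<Rightarrow> 'a ps4 \<Rightarrow> 'a ps4"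
  where "subst4 F f1 f2 g1 g2 = mk_ps4 (\<lambda>i j k l. let n = i + j + k + l in
    \<Sum>p\<le>n. \<Sum>q\<le>n. \<Sum>r\<le>n. \<Sum>s\<le>n.
      coeff4 F p q r s * coeff4 (f1 ^ p * f2 ^ q * g1 ^ r * g2 ^ s) i j k l)"

typedef GL2Z = "{M :: int ^ 2 ^ 2. invertible M}"
  by (rule exI[of _ "mat 1"]) (auto simp: invertible_def)

setup_lifting type_definition_GL2Z

lemma invertibleI: "A ** B = mat 1 \<Longrightarrow> B ** A = mat 1 \<Longrightarrow> invertible A"
  unfolding invertible_def by blast

lemma invertible_matrix_inv:
  assumes "invertible A"
  shows "A ** matrix_inv A = mat 1" "matrix_inv A ** A = mat 1"
  using someI_ex[OF assms[unfolded invertible_def]] unfolding matrix_inv_def by auto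

text \<open>
  The group law is written additively, since \<open>Poly_Mapping\<close> provides the convolution product
  only for an additive (not necessarily commutative) monoid of exponents: here \<open>+\<close> is the
  matrix product, \<open>0\<close> the identity matrix and \<open>-\<close> the matrix inverse.
\<close>

instantiation GL2Z :: group_add
begin

lift_definition zero_GL2Z :: GL2Z is "mat 1"
  by (rule invertibleI[of _ "mat 1"]) simp_all

lift_definition plus_GL2Z :: "GL2Z \<Rightarrow> GL2Z \<Rightarrow> GL2Z" is "\<lambda>M N. M ** N"
proof -
  fix M N :: "int ^ 2 ^ 2"
  assume "invertible M" "invertible N"
  then obtain M' N' where "M ** M' = mat 1" "M' ** M = mat 1" "N ** N' = mat 1" "N' ** N = mat 1"
    unfolding invertible_def by blast
  moreover have "(M ** N) ** (N' ** M') = M ** (N ** N') ** M'"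
    and "(N' ** M') ** (M ** N) = N' ** (M' ** M) ** N"
    by (simp_all only: matrix_mul_assoc)
  ultimately show "invertible (M ** N)"
    by (intro invertibleI[of _ "N' ** M'"]) simp_all
qed

lift_definition uminus_GL2Z :: "GL2Z \<Rightarrow> GL2Z" is matrix_inv
  using invertible_matrix_inv invertibleI by blast

definition minus_GL2Z :: "GL2Z \<Rightarrow> GL2Z \<Rightarrow> GL2Z" where "M - N = M + - (N :: GL2Z)"

instance
proof
  fix a b c :: GL2Z
  show "a + b + c = a + (b + c)" by transfer (simp add: matrix_mul_assoc)
  show "0 + a = a" "a + 0 = a" by (transfer; simp)+
  show "- a + a = 0" by transfer (simp add: invertible_matrix_inv)
  show "a + - b = a - b" by (simp add: minus_GL2Z_def)
qed

end

lemma mat2_mult: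
  "(vector [vector [a, b], vector [c, d]] :: int ^ 2 ^ 2) ** (vector [vector [a', b'], vector [c', d']] :: int ^ 2 ^ 2)
    = vector [vector [a * a' + b * c', a * b' + b * d'], vector [c * a' + d * c', c * b' + d * d']]"
  by (simp add: vec_eq_iff forall_2 matrix_matrix_mult_def sum_2)

lemma mat2_one: "(mat 1 :: int ^ 2 ^ 2) = vector [vector [1, 0], vector [0, 1]]"
  by (simp add: vec_eq_iff forall_2 mat_def)

lift_definition eps_mat :: GL2Z is "vector [vector [0, 1], vector [1, 0]]"
  by (rule invertibleI[of _ "vector [vector [0, 1], vector [1, 0]]"])
    (simp_all add: mat2_mult mat2_one)

lift_definition T_mat :: GL2Z is "vector [vector [1, 1], vector [0, 1]]"
  by (rule invertibleI[of _ "vector [vector [1, -1], vector [0, 1]]"])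
    (simp_all add: mat2_mult mat2_one)

lift_definition S_mat :: GL2Z is "vector [vector [0, -1], vector [1, 0]]"
  by (rule invertibleI[of _ "vector [vector [0, 1], vector [-1, 0]]"])
    (simp_all add: mat2_mult mat2_one)

lift_definition U_mat :: GL2Z is "vector [vector [1, -1], vector [1, 0]]"
  by (rule invertibleI[of _ "vector [vector [0, 1], vector [-1, 1]]"])
    (simp_all add: mat2_mult mat2_one)

type_synonym group_ring = "GL2Z \<Rightarrow>\<^sub>0 int"

abbreviation gr :: "GL2Z \<Rightarrow> group_ring" where "gr \<gamma> \<equiv> Poly_Mapping.single \<gamma> 1"

definition eps :: group_ring where "eps = gr eps_mat"
definition T :: group_ring where "T = gr T_mat"
definition Tinv :: group_ring where "Tinv = gr (- T_mat)"
definition S :: group_ring where "S = gr S_mat"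
definition U :: group_ring where "U = gr U_mat"

definition slash_mat :: "'a :: comm_ring_1 ps4 \<Rightarrow> GL2Z \<Rightarrow> 'a ps4"
  where "slash_mat R \<gamma> =
    (let M = Rep_GL2Z \<gamma>; a = M $ 1 $ 1; b = M $ 1 $ 2; c = M $ 2 $ 1; d = M $ 2 $ 2 in
      subst4 R (of_int a * X1 + of_int b * X2) (of_int c * X1 + of_int d * X2)
        (of_int (det M) * (of_int d * Y1 - of_int c * Y2))
        (of_int (det M) * (- of_int b * Y1 + of_int a * Y2)))"

definition slash :: "'a :: comm_ring_1 ps4 \<Rightarrow> group_ring \<Rightarrow> 'a ps4"  (infixl \<open>\<bar>\<^sub>s\<close> 68)
  where "R \<bar>\<^sub>s g = (\<Sum>\<gamma>\<in>Poly_Mapping.keys g. of_int (Poly_Mapping.lookup g \<gamma>) * slash_mat R \<gamma>)"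

text \<open>
  Each \<open>\<gamma>\<close> acts on power series by a ring automorphism, hence also on fractions:
  \<open>(N / D) | \<gamma> = (N | \<gamma>) / (D | \<gamma>)\<close>, independently of the representation. A Laurent series is a
  fraction with a power of \<open>X\<^sub>1 X\<^sub>2 Y\<^sub>1 Y\<^sub>2\<close> as denominator; its images under \<open>\<gamma>\<close> are in general
  not Laurent series any more.
\<close>

definition fslash_mat :: "'a :: comm_ring_1 ps4 total_fract \<Rightarrow> GL2Z \<Rightarrow> 'a ps4 total_fract"
  where "fslash_mat R \<gamma> = (THE Q. \<exists>N D. regular D \<and> R = tfrac N D \<and>
    Q = tfrac (slash_mat N \<gamma>) (slash_mat D \<gamma>))"

definition fslash :: "'a :: comm_ring_1 ps4 total_fract \<Rightarrow> group_ring \<Rightarrow> 'a ps4 total_fract"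
    (infixl \<open>\<bar>\<^sub>f\<close> 68)
  where "R \<bar>\<^sub>f g = (\<Sum>\<gamma>\<in>Poly_Mapping.keys g. of_int (Poly_Mapping.lookup g \<gamma>) * fslash_mat R \<gamma>)"

definition laurent4 :: "'a :: comm_ring_1 ps4 total_fract set"
  where "laurent4 = {tfrac F ((X1 * X2 * Y1 * Y2) ^ n) | F n. True}"

definition W_plus :: "'a :: comm_ring_1 ps4 total_fract set"
  where "W_plus = {R \<in> laurent4. R \<bar>\<^sub>f (1 + U + U\<^sup>2) = 0 \<and> R \<bar>\<^sub>f (1 + S) = 0 \<and> R \<bar>\<^sub>f (1 - eps) = 0}"

text \<open>
  The divisions are exact, and the quotients are unique because \<open>X\<^sub>1 - X\<^sub>2\<close> and \<open>Y\<^sub>1 - Y\<^sub>2\<close> are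
  regular.
\<close>

definition R_stuffle :: "'a :: comm_ring_1 ps2 \<Rightarrow> 'a ps4"
  where "R_stuffle F =
    (THE Q. (X1 - X2) * Q = subst2 F X1 (Y1 + Y2) - subst2 F X2 (Y1 + Y2))"

definition R_shuffle :: "'a :: comm_ring_1 ps2 \<Rightarrow> 'a ps4"
  where "R_shuffle F =
    (THE Q. (Y1 - Y2) * Q = subst2 F (X1 + X2) Y1 - subst2 F (X1 + X2) Y2)"

text \<open>\<open>G1s k d\<close>, \<open>G2s k1 k2 d1 d2\<close> and \<open>P2s k1 k2 d1 d2\<close>; upper indices first.\<close>

datatype eis_symbol = G1s nat nat | G2s nat nat nat nat | P2s nat nat nat nat

text \<open>
  The generating series need coefficients in a commutative \<open>\<rat>\<close>-algebra containing the free
  \<open>\<rat>\<close>-vector space on the symbols. We take the polynomial ring over \<open>\<rat>\<close> in the symbols;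
  its linear forms are that free vector space.
\<close>

type_synonym eis_poly = "(eis_symbol \<Rightarrow>\<^sub>0 nat) \<Rightarrow>\<^sub>0 rat"

definition eis_sym :: "eis_symbol \<Rightarrow> eis_poly"
  where "eis_sym s = Poly_Mapping.single (Poly_Mapping.single s 1) 1"

definition gen_G1 :: "eis_poly ps2"
  where "gen_G1 = mk_ps2 (\<lambda>i d. (1 / fact d) *\<^sub>Q eis_sym (G1s (i + 1) d))"

definition gen_G2 :: "eis_poly ps4"
  where "gen_G2 = mk_ps4 (\<lambda>i j d1 d2.
    (1 / (fact d1 * fact d2)) *\<^sub>Q eis_sym (G2s (i + 1) (j + 1) d1 d2))"

definition gen_P :: "eis_poly ps4"
  where "gen_P = mk_ps4 (\<lambda>i j d1 d2.
    (1 / (fact d1 * fact d2)) *\<^sub>Q eis_sym (P2s (i + 1) (j + 1) d1 d2))"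

definition eis_symbols :: "nat \<Rightarrow> eis_symbol set"
  where "eis_symbols K =
    {G1s k d | k d. k \<ge> 1 \<and> k + d = K} \<union>
    {G2s k1 k2 d1 d2 | k1 k2 d1 d2. k1 \<ge> 1 \<and> k2 \<ge> 1 \<and> k1 + k2 + d1 + d2 = K} \<union>
    {P2s k1 k2 d1 d2 | k1 k2 d1 d2. k1 \<ge> 1 \<and> k2 \<ge> 1 \<and> k1 + k2 + d1 + d2 = K}"

definition eis_free :: "nat \<Rightarrow> eis_poly set"
  where "eis_free K = module.span scaleQ (eis_sym ` eis_symbols K)"

text \<open>
  The coefficient of \<open>X\<^sub>1^(k\<^sub>1-1) X\<^sub>2^(k\<^sub>2-1) Y\<^sub>1^d\<^sub>1 Y\<^sub>2^d\<^sub>2\<close> only involves symbols of weight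
  \<open>k\<^sub>1 + k\<^sub>2 + d\<^sub>1 + d\<^sub>2\<close>, which is the degree of the monomial plus 2.
\<close>

definition eis_relations :: "nat \<Rightarrow> eis_poly set"
  where "eis_relations K = module.span scaleQ
    {coeff4 D i j k l | D i j k l. i + j + k + l + 2 = K \<and>
      D \<in> {gen_P - (gen_G2 \<bar>\<^sub>s (1 + eps) + R_stuffle gen_G1),
           gen_P - (gen_G2 \<bar>\<^sub>s (T * (1 + eps)) + R_shuffle gen_G1)}}"

text \<open>\<open>eis_space K\<close> is the quotient of \<open>eis_free K\<close> by \<open>eis_relations K\<close>; its elements are cosets.\<close>

definition eis_class :: "nat \<Rightarrow> eis_poly \<Rightarrow> eis_poly set"
  where "eis_class K x = {x + w | w. w \<in> eis_relations K}"

definition eis_space :: "nat \<Rightarrow> eis_poly set set"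
  where "eis_space K = eis_class K ` eis_free K"

definition eis_add :: "eis_poly set \<Rightarrow> eis_poly set \<Rightarrow> eis_poly set"
  where "eis_add u v = {x + y | x y. x \<in> u \<and> y \<in> v}"

text \<open>The summand \<open>w\<close> matters only for \<open>c = 0\<close>.\<close>

definition eis_scale :: "nat \<Rightarrow> rat \<Rightarrow> eis_poly set \<Rightarrow> eis_poly set"
  where "eis_scale K c u = {c *\<^sub>Q x + w | x w. x \<in> u \<and> w \<in> eis_relations K}"

definition realization :: "nat \<Rightarrow> (eis_poly set \<Rightarrow> 'a :: rat_algebra) \<Rightarrow> bool"
  where "realization K \<phi> \<longleftrightarrow>
    (\<forall>u\<in>eis_space K. \<forall>v\<in>eis_space K. \<phi> (eis_add u v) = \<phi> u + \<phi> v) \<and>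
    (\<forall>c. \<forall>u\<in>eis_space K. \<phi> (eis_scale K c u) = c *\<^sub>Q \<phi> u)"

end

theory Submission
  imports Defs
begin

text \<open>
  For \<open>W\<close> in \<open>W_plus\<close> the relations \<open>W | S = -W\<close>, \<open>W | \<epsilon> = W\<close> and the identities \<open>T\<^sup>-\<^sup>1 = S\<^sup>3 U\<^sup>2\<close>,
  \<open>U\<^sup>2 \<epsilon> = \<epsilon> S\<^sup>2 U\<close>, \<open>T = S\<^sup>2 U S\<close>, \<open>T \<epsilon> = \<epsilon> S\<^sup>2 U\<^sup>2 S\<close> turn \<open>W | (1 + U + U\<^sup>2) = 0\<close> into
  \<open>W | (1 + T\<^sup>-\<^sup>1)(1 + \<epsilon>) = 3 W = W | (1 + T\<^sup>-\<^sup>1) T (1 + \<epsilon>)\<close>. Hence \<open>W | (1 + T\<^sup>-\<^sup>1) / 3\<close> solves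
  both equations up to the contribution of the polar part. By oddness of \<open>B\<^sub>1\<close> the latter only
  involves ten values of \<open>B\<^sub>1\<close> at pairs of linear forms, each multiplied by inverses of linear
  forms, and these terms cancel identically, without any partial fraction relation.

  The realization sends a linear form in the symbols to \<open>A\<close>. An additive map applied to all
  coefficients commutes with substitutions that have integer coefficients, so it maps the defining
  relations to the two equations.
\<close>

section \<open>Substitution in power series of four variables\<close>

lemma ps4_eqI: "(\<And>i j k l. coeff4 F i j k l = coeff4 G i j k l) \<Longrightarrow> F = G"
  by (simp add: coeff4_def fps_eq_iff)

lemma coeff4_zero [simp]: "coeff4 0 i j k l = 0"
  and coeff4_one: "coeff4 1 i j k l = (if i = 0 \<and> j = 0 \<and> k = 0 \<and> l = 0 then 1 else 0)"
  and coeff4_add: "coeff4 (F + G) i j k l = coeff4 F i j k l + coeff4 G i j k l"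
  by (simp_all add: coeff4_def)

lemma coeff4_diff: "coeff4 (F - G) i j k l = coeff4 F i j k l - coeff4 G i j k l"
  and coeff4_uminus: "coeff4 (- F) i j k l = - coeff4 F i j k l"
  for F G :: "'a :: comm_ring_1 ps4"
  by (simp_all add: coeff4_def)

lemma coeff4_sum: "coeff4 (\<Sum>x\<in>A. F x) i j k l = (\<Sum>x\<in>A. coeff4 (F x) i j k l)"
  by (simp add: coeff4_def fps_sum_nth)

lemma coeff4_mult:
  "coeff4 (F * G) i j k l = (\<Sum>d\<in>{0..l}. \<Sum>c\<in>{0..k}. \<Sum>b\<in>{0..j}. \<Sum>a\<in>{0..i}.
     coeff4 F a b c d * coeff4 G (i - a) (j - b) (k - c) (l - d))"
  for F G :: "'a :: comm_ring_1 ps4"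
  by (simp add: coeff4_def fps_mult_nth fps_sum_nth)

definition const4 :: "'a :: comm_ring_1 \<Rightarrow> 'a ps4"
  where "const4 c = fps_const (fps_const (fps_const (fps_const c)))"

lemma coeff4_const_mult: "coeff4 (const4 c * F) i j k l = c * coeff4 F i j k l"
  by (simp add: coeff4_def const4_def)

lemma const4_mult: "const4 (c * d) = const4 c * const4 d"
  and const4_1 [simp]: "const4 1 = 1"
  by (simp_all add: const4_def)

lemma const4_of_int: "const4 (of_int n) = of_int n"
  by (simp add: const4_def fps_of_int)

definition monom4 :: "nat \<Rightarrow> nat \<Rightarrow> nat \<Rightarrow> nat \<Rightarrow> 'a :: comm_ring_1 ps4"
  where "monom4 p q r s = X1 ^ p * X2 ^ q * Y1 ^ r * Y2 ^ s"

lemma coeff4_monom4: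
  "coeff4 (monom4 p q r s) i j k l = (if p = i \<and> q = j \<and> r = k \<and> s = l then 1 else 0)"
  by (simp add: coeff4_def monom4_def X1_def X2_def Y1_def Y2_def fps_const_power
      mult.assoc fps_X_power_mult_nth fps_mult_fps_X_power_nonzero)

lemma monom4_mult: "monom4 p q r s * monom4 p' q' r' s' = monom4 (p + p') (q + q') (r + r') (s + s')"
  by (simp add: monom4_def power_add ac_simps)

lemma sum4_delta:
  fixes n :: nat
  shows "(\<Sum>a\<le>n. \<Sum>b\<le>n. \<Sum>c\<le>n. \<Sum>d\<le>n. if a = p \<and> b = q \<and> c = r \<and> d = s then f a b c d else 0)
    = (if p \<le> n \<and> q \<le> n \<and> r \<le> n \<and> s \<le> n then f p q r s else 0)"
proof -
  have *: "(if C \<and> D then x else 0) = (if C then if D then x else 0 else 0)" for C D and x :: 'a by simp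
  have **: "(\<Sum>b\<le>n. if C then g b else 0) = (if C then \<Sum>b\<le>n. g b else 0)"
    for C and g :: "nat \<Rightarrow> 'a" by simp
  show ?thesis by (simp add: * ** )
qed

lemma sum4_delta':
  fixes n :: nat
  shows "(\<Sum>a\<le>n. \<Sum>b\<le>n. \<Sum>c\<le>n. \<Sum>d\<le>n. if p = a \<and> q = b \<and> r = c \<and> s = d then f a b c d else 0)
    = (if p \<le> n \<and> q \<le> n \<and> r \<le> n \<and> s \<le> n then f p q r s else 0)"
  using sum4_delta[of p q r s f n] by (simp only: eq_commute)

section \<open>The filtration by total degree, which takes the place of a topology\<close>

definition ord4_ge :: "nat \<Rightarrow> 'a :: comm_ring_1 ps4 \<Rightarrow> bool"
  where "ord4_ge n F \<longleftrightarrow> (\<forall>i j k l. i + j + k + l < n \<longrightarrow> coeff4 F i j k l = 0)"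

lemma ord4_geD: "ord4_ge n F \<Longrightarrow> i + j + k + l < n \<Longrightarrow> coeff4 F i j k l = 0"
  by (simp add: ord4_ge_def)

lemma ord4_ge_0 [simp]: "ord4_ge 0 F"
  by (simp add: ord4_ge_def)

lemma ord4_ge_zero [simp]: "ord4_ge n 0"
  by (simp add: ord4_ge_def)

lemma ord4_ge_add: "ord4_ge n F \<Longrightarrow> ord4_ge n G \<Longrightarrow> ord4_ge n (F + G)"
  and ord4_ge_diff: "ord4_ge n F \<Longrightarrow> ord4_ge n G \<Longrightarrow> ord4_ge n (F - G)"
  and ord4_ge_uminus: "ord4_ge n F \<Longrightarrow> ord4_ge n (- F)"
  by (simp_all add: ord4_ge_def coeff4_add coeff4_diff coeff4_uminus)

text \<open>If exponents of total degree below m + n are split between the two factors, the share of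
  F has degree below m or the share of G has degree below n.\<close>

lemma ord4_ge_mult:
  assumes "ord4_ge m F" "ord4_ge n G"
  shows "ord4_ge (m + n) (F * G)"
  unfolding ord4_ge_def coeff4_mult
proof (intro allI impI sum.neutral ballI)
  fix i j k l a b c d
  assume *: "i + j + k + l < m + n" "d \<in> {0..l}" "c \<in> {0..k}" "b \<in> {0..j}" "a \<in> {0..i}"
  show "coeff4 F a b c d * coeff4 G (i - a) (j - b) (k - c) (l - d) = 0"
  proof (cases "a + b + c + d < m")
    case True
    thus ?thesis using ord4_geD[OF assms(1)] by simp
  next
    case False
    hence "(i - a) + (j - b) + (k - c) + (l - d) < n" using * by auto
    thus ?thesis using ord4_geD[OF assms(2)] by simp
  qed
qed

lemma ord4_ge_mult_left: "ord4_ge n G \<Longrightarrow> ord4_ge n (F * G)"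
  and ord4_ge_mult_right: "ord4_ge n G \<Longrightarrow> ord4_ge n (G * F)"
  using ord4_ge_mult[of 0 F n G] ord4_ge_mult[of n G 0 F] by simp_all

lemma ord4_ge_power: "ord4_ge 1 F \<Longrightarrow> ord4_ge n (F ^ n)"
proof (induction n)
  case (Suc n)
  thus ?case using ord4_ge_mult[of 1 F n "F ^ n"] by simp
qed simp

lemma ord4_ge_vars: "ord4_ge 1 X1" "ord4_ge 1 X2" "ord4_ge 1 Y1" "ord4_ge 1 Y2"
  by (simp_all add: ord4_ge_def coeff4_def X1_def X2_def Y1_def Y2_def)

text \<open>The filtration is separated: a coefficient of degree N is already decided at order N +
  1.\<close>

lemma ord4_ge_all_imp_eq:
  assumes "\<And>n. ord4_ge n (F - G)"
  shows "F = G"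
proof (rule ps4_eqI)
  fix i j k l
  show "coeff4 F i j k l = coeff4 G i j k l"
    using ord4_geD[OF assms, of i j k l "Suc (i + j + k + l)"] by (simp add: coeff4_diff)
qed

text \<open>Cutting off by a box of exponents instead of by total degree keeps the four sums
  independent of each other; the remainder still has order at least n.\<close>

definition trunc4 :: "nat \<Rightarrow> 'a :: comm_ring_1 ps4 \<Rightarrow> 'a ps4"
  where "trunc4 n F = (\<Sum>p\<le>n. \<Sum>q\<le>n. \<Sum>r\<le>n. \<Sum>s\<le>n. const4 (coeff4 F p q r s) * monom4 p q r s)"

lemma ord4_ge_trunc4: "ord4_ge n (F - trunc4 n F)"
  by (auto simp: ord4_ge_def coeff4_diff trunc4_def coeff4_sum coeff4_const_mult coeff4_monom4
      if_distrib[of "\<lambda>x. _ * x"] sum4_delta cong: if_cong)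

text \<open>A density argument. Additive maps that respect the filtration are continuous and
  polynomials are dense, so equality on single terms suffices. Multiplicativity and composition of
  substitutions are reduced to monomials in this way.\<close>

lemma additive_maps_eqI:
  fixes \<phi> \<psi> :: "'a :: comm_ring_1 ps4 \<Rightarrow> 'b :: comm_ring_1 ps4"
  assumes add: "\<And>F G. \<phi> (F + G) = \<phi> F + \<phi> G" "\<And>F G. \<psi> (F + G) = \<psi> F + \<psi> G"
    and ord: "\<And>n F. ord4_ge n F \<Longrightarrow> ord4_ge n (\<phi> F)" "\<And>n F. ord4_ge n F \<Longrightarrow> ord4_ge n (\<psi> F)"
    and terms: "\<And>c p q r s. \<phi> (const4 c * monom4 p q r s) = \<psi> (const4 c * monom4 p q r s)"
  shows "\<phi> F = \<psi> F"
proof (rule ord4_ge_all_imp_eq)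
  fix n
  have z: "\<phi> 0 = 0" "\<psi> 0 = 0" using add(1)[of 0 0] add(2)[of 0 0] by simp_all
  have sum: "\<phi> (\<Sum>x\<le>n. F x) = (\<Sum>x\<le>n. \<phi> (F x))" "\<psi> (\<Sum>x\<le>n. F x) = (\<Sum>x\<le>n. \<psi> (F x))"
    for n :: nat and F
    by (induction n) (simp_all add: add)
  have eq: "\<phi> (trunc4 n F) = \<psi> (trunc4 n F)"
    by (simp add: trunc4_def sum terms)
  have "\<phi> F = \<phi> (F - trunc4 n F) + \<phi> (trunc4 n F)" "\<psi> F = \<psi> (F - trunc4 n F) + \<psi> (trunc4 n F)"
    by (simp_all flip: add)
  hence "\<phi> F - \<psi> F = \<phi> (F - trunc4 n F) - \<psi> (F - trunc4 n F)" by (simp add: eq)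
  thus "ord4_ge n (\<phi> F - \<psi> F)"
    using ord4_ge_diff[OF ord(1) ord(2)] ord4_ge_trunc4 by metis
qed

section \<open>Substitution of series without constant term as a ring homomorphism\<close>

locale subst_point =
  fixes f1 f2 g1 g2 :: "'a :: comm_ring_1 ps4"
  assumes f1: "ord4_ge 1 f1" and f2: "ord4_ge 1 f2" and g1: "ord4_ge 1 g1" and g2: "ord4_ge 1 g2"
begin

abbreviation subst :: "'a ps4 \<Rightarrow> 'a ps4" where "subst F \<equiv> subst4 F f1 f2 g1 g2"

definition pow :: "nat \<Rightarrow> nat \<Rightarrow> nat \<Rightarrow> nat \<Rightarrow> 'a ps4"
  where "pow p q r s = f1 ^ p * f2 ^ q * g1 ^ r * g2 ^ s"

lemma ord_pow: "ord4_ge (p + q + r + s) (pow p q r s)"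
  unfolding pow_def by (intro ord4_ge_mult ord4_ge_power f1 f2 g1 g2)

lemma coeff4_pow: "i + j + k + l < p + q + r + s \<Longrightarrow> coeff4 (pow p q r s) i j k l = 0"
  using ord_pow ord4_geD by blast

lemma coeff4_subst: "coeff4 (subst F) i j k l = (let n = i + j + k + l in
    \<Sum>p\<le>n. \<Sum>q\<le>n. \<Sum>r\<le>n. \<Sum>s\<le>n. coeff4 F p q r s * coeff4 (pow p q r s) i j k l)"
  by (simp add: subst4_def pow_def)

lemma subst_add: "subst (F + G) = subst F + subst G"
  by (rule ps4_eqI) (simp add: coeff4_subst coeff4_add distrib_right sum.distrib Let_def)

text \<open>In each product of the defining sum, either the coefficient of F vanishes because its
  degree is below n, or the power product has order at least n and contributes nothing to the
  coefficient in question.\<close>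

lemma ord_subst:
  assumes "ord4_ge n F"
  shows "ord4_ge n (subst F)"
  unfolding ord4_ge_def coeff4_subst Let_def
proof (intro allI impI sum.neutral ballI)
  fix i j k l p q r s
  assume *: "i + j + k + l < n"
  show "coeff4 F p q r s * coeff4 (pow p q r s) i j k l = 0"
    using ord4_geD[OF assms] coeff4_pow * by (cases "p + q + r + s < n") simp_all
qed

lemma subst_monom: "subst (const4 c * monom4 p q r s) = const4 c * pow p q r s"
  by (rule ps4_eqI)
    (auto simp: coeff4_subst coeff4_const_mult coeff4_monom4 Let_def sum4_delta' coeff4_pow
      if_distrib[of "\<lambda>x. _ * x"] if_distrib[of "\<lambda>x. x * _"] cong: if_cong)

lemma pow_mult: "pow p q r s * pow p' q' r' s' = pow (p + p') (q + q') (r + r') (s + s')"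
  by (simp add: pow_def power_add ac_simps)

text \<open>Density is used twice, first in F with G arbitrary, then in G with F a single term. What
  remains is the addition of exponents.\<close>

lemma subst_mult: "subst (F * G) = subst F * subst G"
proof (rule additive_maps_eqI[of "\<lambda>F. subst (F * G)" "\<lambda>F. subst F * subst G"])
  fix c p q r s
  show "subst (const4 c * monom4 p q r s * G) = subst (const4 c * monom4 p q r s) * subst G"
  proof (rule additive_maps_eqI[of "\<lambda>G. subst (_ * G)" "\<lambda>G. subst _ * subst G"])
    fix c' p' q' r' s'
    have "const4 c * monom4 p q r s * (const4 c' * monom4 p' q' r' s')
      = const4 (c * c') * monom4 (p + p') (q + q') (r + r') (s + s')"
      by (simp only: const4_mult ac_simps flip: monom4_mult)
    moreover have "const4 c * pow p q r s * (const4 c' * pow p' q' r' s')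
      = const4 (c * c') * pow (p + p') (q + q') (r + r') (s + s')"
      by (simp only: const4_mult ac_simps flip: pow_mult)
    ultimately show "subst (const4 c * monom4 p q r s * (const4 c' * monom4 p' q' r' s'))
      = subst (const4 c * monom4 p q r s) * subst (const4 c' * monom4 p' q' r' s')"
      by (simp only: subst_monom)
  qed (simp_all add: subst_add distrib_left ord_subst ord4_ge_mult_left)
qed (simp_all add: subst_add distrib_right ord_subst ord4_ge_mult_right)

lemma subst_const: "subst (const4 c) = const4 c"
  using subst_monom[of c 0 0 0 0] by (simp add: monom4_def pow_def)

lemma subst_1: "subst 1 = 1"
  using subst_const[of 1] by simp

lemma subst_of_int: "subst (of_int n) = of_int n"
  using subst_const[of "of_int n"] by (simp add: const4_of_int)

lemma subst_0: "subst 0 = 0"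
  using subst_of_int[of 0] by simp

lemma subst_uminus: "subst (- F) = - subst F"
proof -
  have "subst (- F) + subst F = 0" by (simp flip: subst_add add: subst_0)
  thus ?thesis by (simp add: eq_neg_iff_add_eq_0)
qed

lemma subst_diff: "subst (F - G) = subst F - subst G"
  using subst_add[of F "- G"] by (simp add: subst_uminus)

lemma subst_power: "subst (F ^ n) = subst F ^ n"
  by (induction n) (simp_all add: subst_1 subst_mult)

lemma subst_X1: "subst X1 = f1"
  and subst_X2: "subst X2 = f2"
  and subst_Y1: "subst Y1 = g1"
  and subst_Y2: "subst Y2 = g2"
  using subst_monom[of 1 1 0 0 0] subst_monom[of 1 0 1 0 0]
    subst_monom[of 1 0 0 1 0] subst_monom[of 1 0 0 0 1]
  by (simp_all add: monom4_def pow_def)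

end

text \<open>Both sides are additive in F and respect the filtration; on a monomial the claim is the
  multiplicativity of the outer substitution.\<close>

lemma subst4_subst4:
  assumes f: "ord4_ge 1 f1" "ord4_ge 1 f2" "ord4_ge 1 g1" "ord4_ge 1 g2"
    and h: "ord4_ge 1 h1" "ord4_ge 1 h2" "ord4_ge 1 k1" "ord4_ge 1 k2"
  shows "subst4 (subst4 F f1 f2 g1 g2) h1 h2 k1 k2
    = subst4 F (subst4 f1 h1 h2 k1 k2) (subst4 f2 h1 h2 k1 k2)
        (subst4 g1 h1 h2 k1 k2) (subst4 g2 h1 h2 k1 k2)"
proof -
  interpret f: subst_point f1 f2 g1 g2 using f by unfold_locales
  interpret h: subst_point h1 h2 k1 k2 using h by unfold_locales
  interpret fh: subst_point "h.subst f1" "h.subst f2" "h.subst g1" "h.subst g2"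
    by unfold_locales (intro h.ord_subst f)+
  show ?thesis
  proof (rule additive_maps_eqI[of "\<lambda>F. h.subst (f.subst F)" fh.subst])
    fix c p q r s
    show "h.subst (f.subst (const4 c * monom4 p q r s)) = fh.subst (const4 c * monom4 p q r s)"
      by (simp only: f.subst_monom fh.subst_monom f.pow_def fh.pow_def
          h.subst_mult h.subst_power h.subst_const)
  qed (simp_all add: f.subst_add h.subst_add fh.subst_add f.ord_subst h.ord_subst fh.ord_subst)
qed

lemma subst4_X_Y: "subst4 F X1 X2 Y1 Y2 = F"
proof -
  interpret subst_point X1 X2 Y1 Y2 by unfold_locales (rule ord4_ge_vars)+
  show ?thesis
  proof (rule additive_maps_eqI[of subst "\<lambda>F. F"])
    fix c p q r s
    show "subst (const4 c * monom4 p q r s) = const4 c * monom4 p q r s"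
      unfolding subst_monom by (simp add: pow_def monom4_def)
  qed (simp_all add: subst_add ord_subst)
qed

section \<open>The action on power series and exact divisions\<close>

lemma of_int_comb_ord:
  "ord4_ge n F \<Longrightarrow> ord4_ge n G \<Longrightarrow> ord4_ge n (of_int a * F + of_int b * G)"
  "ord4_ge n F \<Longrightarrow> ord4_ge n G \<Longrightarrow> ord4_ge n (of_int c * (of_int a * F - of_int b * G))"
  "ord4_ge n F \<Longrightarrow> ord4_ge n G \<Longrightarrow> ord4_ge n (of_int c * (- of_int a * F + of_int b * G))"
  by (simp_all add: ord4_ge_mult_left ord4_ge_add ord4_ge_diff ord4_ge_uminus)

section \<open>The action of GL2(Z) as a substitution\<close>

definition slash_x1 :: "GL2Z \<Rightarrow> 'a :: comm_ring_1 ps4"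
  where "slash_x1 \<gamma> = of_int (Rep_GL2Z \<gamma> $ 1 $ 1) * X1 + of_int (Rep_GL2Z \<gamma> $ 1 $ 2) * X2"
definition slash_x2 :: "GL2Z \<Rightarrow> 'a :: comm_ring_1 ps4"
  where "slash_x2 \<gamma> = of_int (Rep_GL2Z \<gamma> $ 2 $ 1) * X1 + of_int (Rep_GL2Z \<gamma> $ 2 $ 2) * X2"
definition slash_y1 :: "GL2Z \<Rightarrow> 'a :: comm_ring_1 ps4"
  where "slash_y1 \<gamma> = of_int (det (Rep_GL2Z \<gamma>)) *
    (of_int (Rep_GL2Z \<gamma> $ 2 $ 2) * Y1 - of_int (Rep_GL2Z \<gamma> $ 2 $ 1) * Y2)"
definition slash_y2 :: "GL2Z \<Rightarrow> 'a :: comm_ring_1 ps4"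
  where "slash_y2 \<gamma> = of_int (det (Rep_GL2Z \<gamma>)) *
    (- of_int (Rep_GL2Z \<gamma> $ 1 $ 2) * Y1 + of_int (Rep_GL2Z \<gamma> $ 1 $ 1) * Y2)"

lemmas slash_vars_def = slash_x1_def slash_x2_def slash_y1_def slash_y2_def

lemma slash_mat_subst4: "slash_mat R \<gamma> = subst4 R (slash_x1 \<gamma>) (slash_x2 \<gamma>) (slash_y1 \<gamma>) (slash_y2 \<gamma>)"
  by (simp add: slash_mat_def slash_vars_def Let_def)

lemma ord_slash_vars:
  "ord4_ge 1 (slash_x1 \<gamma>)" "ord4_ge 1 (slash_x2 \<gamma>)" "ord4_ge 1 (slash_y1 \<gamma>)" "ord4_ge 1 (slash_y2 \<gamma>)"
  unfolding slash_vars_def by (intro of_int_comb_ord ord4_ge_vars)+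

interpretation slash: subst_point "slash_x1 \<gamma>" "slash_x2 \<gamma>" "slash_y1 \<gamma>" "slash_y2 \<gamma>"
  by unfold_locales (rule ord_slash_vars)+

lemmas slash_mat_add = slash.subst_add[folded slash_mat_subst4]
  and slash_mat_diff = slash.subst_diff[folded slash_mat_subst4]
  and slash_mat_uminus = slash.subst_uminus[folded slash_mat_subst4]
  and slash_mat_mult = slash.subst_mult[folded slash_mat_subst4]
  and slash_mat_0 = slash.subst_0[folded slash_mat_subst4]
  and slash_mat_1 = slash.subst_1[folded slash_mat_subst4]
  and slash_mat_of_int = slash.subst_of_int[folded slash_mat_subst4]
  and slash_mat_X1 = slash.subst_X1[folded slash_mat_subst4]
  and slash_mat_X2 = slash.subst_X2[folded slash_mat_subst4]
  and slash_mat_Y1 = slash.subst_Y1[folded slash_mat_subst4]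
  and slash_mat_Y2 = slash.subst_Y2[folded slash_mat_subst4]

lemmas slash_mat_simps = slash_mat_add slash_mat_diff slash_mat_uminus slash_mat_mult
  slash_mat_0 slash_mat_1 slash_mat_of_int slash_mat_X1 slash_mat_X2 slash_mat_Y1 slash_mat_Y2

text \<open>A right action, with \<open>+\<close> on \<open>GL2Z\<close> denoting the matrix
  product. By composition of substitutions it is enough to follow the four variables: the X
  transform by the matrix, the Y by the determinant times the cofactor matrix, and both matrices are
  multiplicative.\<close>

lemma slash_mat_slash_mat: "slash_mat (slash_mat R \<gamma>) \<delta> = slash_mat R (\<gamma> + \<delta>)"
  for R :: "'a :: comm_ring_1 ps4"
proof -
  have R: "Rep_GL2Z (\<gamma> + \<delta>) = Rep_GL2Z \<gamma> ** Rep_GL2Z \<delta>" by (simp add: plus_GL2Z.rep_eq)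
  have "slash_mat (slash_x1 \<gamma> :: 'a ps4) \<delta> = slash_x1 (\<gamma> + \<delta>)"
    "slash_mat (slash_x2 \<gamma> :: 'a ps4) \<delta> = slash_x2 (\<gamma> + \<delta>)"
    "slash_mat (slash_y1 \<gamma> :: 'a ps4) \<delta> = slash_y1 (\<gamma> + \<delta>)"
    "slash_mat (slash_y2 \<gamma> :: 'a ps4) \<delta> = slash_y2 (\<gamma> + \<delta>)"
    unfolding slash_vars_def[of \<gamma>] slash_mat_simps
    unfolding slash_vars_def R det_mul
    by (simp_all add: matrix_matrix_mult_def sum_2 algebra_simps)
  moreover have "slash_mat (slash_mat R \<gamma>) \<delta> = subst4 R (slash_mat (slash_x1 \<gamma>) \<delta>)
      (slash_mat (slash_x2 \<gamma>) \<delta>) (slash_mat (slash_y1 \<gamma>) \<delta>) (slash_mat (slash_y2 \<gamma>) \<delta>)"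
    unfolding slash_mat_subst4 by (intro subst4_subst4 ord_slash_vars)
  ultimately show ?thesis by (simp only: slash_mat_subst4)
qed

lemma slash_mat_zero: "slash_mat R 0 = R"
  for R :: "'a :: comm_ring_1 ps4"
proof -
  have "slash_x1 0 = (X1 :: 'a ps4)" "slash_x2 0 = (X2 :: 'a ps4)"
    "slash_y1 0 = (Y1 :: 'a ps4)" "slash_y2 0 = (Y2 :: 'a ps4)"
    by (simp_all add: slash_vars_def zero_GL2Z.rep_eq mat_def det_2)
  thus ?thesis by (simp add: slash_mat_subst4 subst4_X_Y)
qed

text \<open>The action of \<open>- \<gamma>\<close> undoes that of \<open>\<gamma>\<close>, so an
  annihilator of the image is carried back to an annihilator of D.\<close>

lemma regular_slash_mat:
  assumes "regular D"
  shows "regular (slash_mat D \<gamma>)"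
  unfolding regular_def
proof (intro allI impI)
  fix x assume "slash_mat D \<gamma> * x = 0"
  hence "slash_mat (slash_mat D \<gamma> * x) (- \<gamma>) = 0" by (simp add: slash_mat_0)
  hence "D * slash_mat x (- \<gamma>) = 0" by (simp add: slash_mat_mult slash_mat_slash_mat slash_mat_zero)
  hence "slash_mat x (- \<gamma>) = 0" using assms by (simp add: regular_def)
  hence "slash_mat (slash_mat x (- \<gamma>)) \<gamma> = 0" by (simp add: slash_mat_0)
  thus "x = 0" by (simp add: slash_mat_slash_mat slash_mat_zero)
qed

section \<open>Two-variable series inside four-variable series, and divided differences\<close>

definition embed2 :: "'a :: comm_ring_1 ps2 \<Rightarrow> 'a ps4"
  where "embed2 F = mk_ps4 (\<lambda>i j k l. if k = 0 \<and> l = 0 then coeff2 F i j else 0)"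

text \<open>Only exponents r = s = 0 occur in \<open>embed2 F\<close>, so the last two arguments are
  arbitrary. Results on \<open>subst4\<close> thus carry over to \<open>subst2\<close> with any
  convenient filler, such as 0.\<close>

lemma subst2_eq_subst4: "subst2 F f g = subst4 (embed2 F) f g g1 g2"
  for f g g1 g2 :: "'a :: comm_ring_1 ps4"
proof (rule ps4_eqI)
  fix i j k l :: nat
  define n where "n = i + j + k + l"
  have *: "(if C \<and> D then x else 0) = (if C then if D then x else 0 else 0)" for C D and x :: 'a by simp
  have **: "(\<Sum>b\<le>n. if C then h b else 0) = (if C then \<Sum>b\<le>n. h b else 0)"
    for C and h :: "nat \<Rightarrow> 'a" by simp
  have "coeff4 (subst4 (embed2 F) f g g1 g2) i j k l =
     (\<Sum>p\<le>n. \<Sum>q\<le>n. \<Sum>r\<le>n. \<Sum>s\<le>n. if r = 0 then if s = 0 then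
         coeff2 F p q * coeff4 (f ^ p * g ^ q * g1 ^ r * g2 ^ s) i j k l else 0 else 0)"
    by (simp add: subst4_def embed2_def Let_def if_distrib[of "\<lambda>x. x * _"] * flip: n_def cong: if_cong)
  also have "\<dots> = coeff4 (subst2 F f g) i j k l"
    by (simp add: subst2_def Let_def ** flip: n_def)
  finally show "coeff4 (subst2 F f g) i j k l = coeff4 (subst4 (embed2 F) f g g1 g2) i j k l" ..
qed

lemma subst4_subst2:
  assumes f: "ord4_ge 1 f" "ord4_ge 1 g"
    and h: "ord4_ge 1 h1" "ord4_ge 1 h2" "ord4_ge 1 k1" "ord4_ge 1 k2"
  shows "subst4 (subst2 F f g) h1 h2 k1 k2 = subst2 F (subst4 f h1 h2 k1 k2) (subst4 g h1 h2 k1 k2)"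
proof -
  have "subst4 (subst2 F f g) h1 h2 k1 k2 = subst4 (subst4 (embed2 F) f g 0 0) h1 h2 k1 k2"
    by (simp only: subst2_eq_subst4[of F f g 0 0])
  also have "\<dots> = subst4 (embed2 F) (subst4 f h1 h2 k1 k2) (subst4 g h1 h2 k1 k2)
      (subst4 0 h1 h2 k1 k2) (subst4 0 h1 h2 k1 k2)"
    by (intro subst4_subst4 assms ord4_ge_zero)
  finally show ?thesis by (simp only: flip: subst2_eq_subst4)
qed

lemma slash_mat_subst2:
  assumes "ord4_ge 1 f" "ord4_ge 1 g"
  shows "slash_mat (subst2 F f g) \<gamma> = subst2 F (slash_mat f \<gamma>) (slash_mat g \<gamma>)"
  unfolding slash_mat_subst4 by (intro subst4_subst2 assms ord_slash_vars)

lemma subst2_swap: "subst2 F f g = subst2 (mk_ps2 (\<lambda>i j. coeff2 F j i)) g f"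
  unfolding subst2_def Let_def coeff2_mk_ps2 by (subst sum.swap) (simp add: mult.commute)

lemma coeff4_mult_X1: "coeff4 (X1 * F) i j k l = (if i = 0 then 0 else coeff4 F (i - 1) j k l)"
  and coeff4_mult_X2: "coeff4 (X2 * F) i j k l = (if j = 0 then 0 else coeff4 F i (j - 1) k l)"
  and coeff4_mult_Y1: "coeff4 (Y1 * F) i j k l = (if k = 0 then 0 else coeff4 F i j (k - 1) l)"
  and coeff4_mult_Y2: "coeff4 (Y2 * F) i j k l = (if l = 0 then 0 else coeff4 F i j k (l - 1))"
  by (simp_all add: coeff4_def X1_def X2_def Y1_def Y2_def)

lemma regular_X1: "regular (X1 :: 'a :: comm_ring_1 ps4)"
  and regular_X2: "regular (X2 :: 'a ps4)"
  and regular_Y1: "regular (Y1 :: 'a ps4)"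
  and regular_Y2: "regular (Y2 :: 'a ps4)"
proof -
  show "regular (X1 :: 'a ps4)" unfolding regular_def
  proof (intro allI impI ps4_eqI)
    fix F :: "'a ps4" and i j k l assume "X1 * F = 0"
    thus "coeff4 F i j k l = coeff4 0 i j k l" using coeff4_mult_X1[of F "Suc i" j k l] by simp
  qed
  show "regular (X2 :: 'a ps4)" unfolding regular_def
  proof (intro allI impI ps4_eqI)
    fix F :: "'a ps4" and i j k l assume "X2 * F = 0"
    thus "coeff4 F i j k l = coeff4 0 i j k l" using coeff4_mult_X2[of F i "Suc j" k l] by simp
  qed
  show "regular (Y1 :: 'a ps4)" unfolding regular_def
  proof (intro allI impI ps4_eqI)
    fix F :: "'a ps4" and i j k l assume "Y1 * F = 0"
    thus "coeff4 F i j k l = coeff4 0 i j k l" using coeff4_mult_Y1[of F i j "Suc k" l] by simp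
  qed
  show "regular (Y2 :: 'a ps4)" unfolding regular_def
  proof (intro allI impI ps4_eqI)
    fix F :: "'a ps4" and i j k l assume "Y2 * F = 0"
    thus "coeff4 F i j k l = coeff4 0 i j k l" using coeff4_mult_Y2[of F i j k "Suc l"] by simp
  qed
qed

lemma subst2_X1_Y1: "subst2 F X1 Y1 = mk_ps4 (\<lambda>i j k l. if j = 0 \<and> l = 0 then coeff2 F i k else 0)"
  and subst2_X2_Y1: "subst2 F X2 Y1 = mk_ps4 (\<lambda>i j k l. if i = 0 \<and> l = 0 then coeff2 F j k else 0)"
proof -
  have *: "X1 ^ p * Y1 ^ q = monom4 p 0 q 0" "X2 ^ p * Y1 ^ q = monom4 0 p q 0" for p q
    by (simp_all add: monom4_def)
  have s: "(\<Sum>p\<le>n. \<Sum>q\<le>n. if p = i \<and> q = k \<and> C then g p q else 0)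
    = (if C \<and> i \<le> n \<and> k \<le> n then g i k else 0)"
    for i k n :: nat and C and g :: "nat \<Rightarrow> nat \<Rightarrow> 'a"
  proof -
    have "(\<Sum>p\<le>n. \<Sum>q\<le>n. if p = i \<and> q = k \<and> C then g p q else 0)
      = (\<Sum>p\<le>n. if p = i then \<Sum>q\<le>n. if q = k then if C then g p q else 0 else 0 else 0)"
      by (intro sum.cong) (auto intro!: sum.cong)
    thus ?thesis by simp
  qed
  have s': "(\<Sum>p\<le>n. \<Sum>q\<le>n. if p = i \<and> q = k then g p q else 0) = (if i \<le> n \<and> k \<le> n then g i k else 0)"
    for i k n :: nat and g :: "nat \<Rightarrow> nat \<Rightarrow> 'a"
    using s[of i k True g n] by simp
  show "subst2 F X1 Y1 = mk_ps4 (\<lambda>i j k l. if j = 0 \<and> l = 0 then coeff2 F i k else 0)"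
    by (rule ps4_eqI) (simp add: subst2_def Let_def * coeff4_monom4 if_distrib[of "\<lambda>x. _ * x"]
         s s' conj_ac cong: if_cong)
  show "subst2 F X2 Y1 = mk_ps4 (\<lambda>i j k l. if i = 0 \<and> l = 0 then coeff2 F j k else 0)"
    by (rule ps4_eqI) (simp add: subst2_def Let_def * coeff4_monom4 if_distrib[of "\<lambda>x. _ * x"]
         s s' conj_ac cong: if_cong)
qed

text \<open>The generic case X1, X2, Y1 has an explicit quotient; substituting f1, f2, g into that
  identity gives the general case.\<close>

lemma diff_dvd_subst2_diff:
  assumes "ord4_ge 1 f1" "ord4_ge 1 f2" "ord4_ge 1 g"
  shows "f1 - f2 dvd subst2 F f1 g - subst2 F f2 g"
proof -
  interpret subst_point f1 f2 g 0 using assms by unfold_locales simp_all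
  \<comment> \<open>Since X1^m - X2^m is X1 - X2 times the sum of all X1^i X2^j with i + j + 1 = m,
    the coefficient of the quotient at X1^i X2^j Y1^k is that of X^(i+j+1) Y^k in F.\<close>
  define Q where "Q = mk_ps4 (\<lambda>i j k l. if l = 0 then coeff2 F (i + j + 1) k else 0)"
  have "(X1 - X2) * Q = subst2 F X1 Y1 - subst2 F X2 Y1"
    by (rule ps4_eqI) (auto simp: left_diff_distrib coeff4_diff coeff4_mult_X1 coeff4_mult_X2
       subst2_X1_Y1 subst2_X2_Y1 Q_def)
  hence "subst ((X1 - X2) * Q) = subst (subst2 F X1 Y1 - subst2 F X2 Y1)" by simp
  hence "(f1 - f2) * subst Q = subst2 F f1 g - subst2 F f2 g"
    by (simp only: subst_mult subst_diff subst_X1 subst_X2 subst_Y1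
         subst4_subst2[OF _ _ f1 f2 g1 g2] ord4_ge_vars)
  thus ?thesis by (metis dvd_triv_left)
qed

lemma diff_dvd_subst2_diff':
  assumes "ord4_ge 1 f" "ord4_ge 1 g1" "ord4_ge 1 g2"
  shows "g1 - g2 dvd subst2 F f g1 - subst2 F f g2"
  unfolding subst2_swap[of F f] by (rule diff_dvd_subst2_diff) fact+

section \<open>Explicit action of the generators, and regular linear forms\<close>

lemma Rep_T_mat_inv: "Rep_GL2Z (- T_mat) = vector [vector [1, -1], vector [0, 1]]"
proof -
  \<comment> \<open>\<open>matrix_inv\<close> is defined by choice. Uniqueness of inverses in the
    group replaces it by the word S^3 U^2, whose entries can be computed.\<close>
  have "- T_mat = S_mat + S_mat + S_mat + U_mat + U_mat"
    by (rule minus_unique, transfer, simp add: mat2_mult mat2_one)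
  thus ?thesis by (simp add: plus_GL2Z.rep_eq S_mat.rep_eq U_mat.rep_eq mat2_mult)
qed

lemma slash_mat_T_mat:
  "slash_mat X1 T_mat = X1 + X2" "slash_mat X2 T_mat = X2"
  "slash_mat Y1 T_mat = Y1" "slash_mat Y2 T_mat = Y2 - Y1"
  by (simp_all add: slash_mat_simps slash_vars_def T_mat.rep_eq det_2)

lemma slash_mat_T_mat_inv:
  "slash_mat X1 (- T_mat) = X1 - X2" "slash_mat X2 (- T_mat) = X2"
  "slash_mat Y1 (- T_mat) = Y1" "slash_mat Y2 (- T_mat) = Y1 + Y2"
  by (simp_all add: slash_mat_simps slash_vars_def Rep_T_mat_inv det_2)

lemma slash_mat_U_mat:
  "slash_mat X1 U_mat = X1 - X2" "slash_mat X2 U_mat = X1"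
  "slash_mat Y1 U_mat = - Y2" "slash_mat Y2 U_mat = Y1 + Y2"
  by (simp_all add: slash_mat_simps slash_vars_def U_mat.rep_eq det_2)

lemma slash_mat_eps_mat:
  "slash_mat X1 eps_mat = X2" "slash_mat X2 eps_mat = X1"
  "slash_mat Y1 eps_mat = Y2" "slash_mat Y2 eps_mat = Y1"
  by (simp_all add: slash_mat_simps slash_vars_def eps_mat.rep_eq det_2)

text \<open>This and the next three denominators are images of variables under group elements, hence
  regular over every ring of coefficients.\<close>

lemma regular_X1_diff_X2: "regular (X1 - X2)"
  using regular_slash_mat[OF regular_X1, of "- T_mat"] by (simp add: slash_mat_T_mat_inv)

lemma regular_Y1_diff_Y2: "regular (Y1 - Y2)"
  using regular_slash_mat[OF regular_slash_mat[OF regular_Y2, of "T_mat"], of eps_mat]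
  by (simp add: slash_mat_T_mat slash_mat_eps_mat slash_mat_diff)

lemma regular_X1_add_X2: "regular (X1 + X2)"
  using regular_slash_mat[OF regular_X1, of T_mat] by (simp add: slash_mat_T_mat)

lemma regular_Y1_add_Y2: "regular (Y1 + Y2)"
  using regular_slash_mat[OF regular_Y2, of "- T_mat"] by (simp add: slash_mat_T_mat_inv)

text \<open>Divisibility gives existence and regularity of X1 - X2 gives uniqueness, so the definite
  description denotes the exact quotient.\<close>

lemma R_stuffle: "(X1 - X2) * R_stuffle F = subst2 F X1 (Y1 + Y2) - subst2 F X2 (Y1 + Y2)"
proof -
  have "\<exists>Q. (X1 - X2) * Q = subst2 F X1 (Y1 + Y2) - subst2 F X2 (Y1 + Y2)"
    using diff_dvd_subst2_diff[of X1 X2 "Y1 + Y2" F] by (metis dvd_def ord4_ge_vars ord4_ge_add)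
  hence "\<exists>!Q. (X1 - X2) * Q = subst2 F X1 (Y1 + Y2) - subst2 F X2 (Y1 + Y2)"
    using regular_cancel[OF regular_X1_diff_X2] by metis
  thus ?thesis unfolding R_stuffle_def by (rule theI')
qed

lemma R_shuffle: "(Y1 - Y2) * R_shuffle F = subst2 F (X1 + X2) Y1 - subst2 F (X1 + X2) Y2"
proof -
  have "\<exists>Q. (Y1 - Y2) * Q = subst2 F (X1 + X2) Y1 - subst2 F (X1 + X2) Y2"
    using diff_dvd_subst2_diff'[of "X1 + X2" Y1 Y2 F] by (metis dvd_def ord4_ge_vars ord4_ge_add)
  hence "\<exists>!Q. (Y1 - Y2) * Q = subst2 F (X1 + X2) Y1 - subst2 F (X1 + X2) Y2"
    using regular_cancel[OF regular_Y1_diff_Y2] by metis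
  thus ?thesis unfolding R_shuffle_def by (rule theI')
qed

section \<open>The group ring and fractions\<close>

text \<open>A common form of the actions on series and on fractions, so that each group ring element
  has to be expanded only once.\<close>

definition lin_ext :: "(GL2Z \<Rightarrow> 'b :: comm_ring_1) \<Rightarrow> group_ring \<Rightarrow> 'b"
  where "lin_ext f g = (\<Sum>\<gamma>\<in>Poly_Mapping.keys g. of_int (Poly_Mapping.lookup g \<gamma>) * f \<gamma>)"

lemma slash_eq_lin_ext: "R \<bar>\<^sub>s g = lin_ext (slash_mat R) g"
  and fslash_eq_lin_ext: "Q \<bar>\<^sub>f g = lin_ext (fslash_mat Q) g"
  by (simp_all add: slash_def fslash_def lin_ext_def)

lemma lin_ext_superset:
  assumes "finite A" "Poly_Mapping.keys g \<subseteq> A"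
  shows "lin_ext f g = (\<Sum>\<gamma>\<in>A. of_int (Poly_Mapping.lookup g \<gamma>) * f \<gamma>)"
  unfolding lin_ext_def by (rule sum.mono_neutral_left) (use assms in \<open>auto simp: in_keys_iff\<close>)

lemma lin_ext_add: "lin_ext f (g + h) = lin_ext f g + lin_ext f h"
proof -
  have "lin_ext f x = (\<Sum>\<gamma>\<in>Poly_Mapping.keys g \<union> Poly_Mapping.keys h. of_int (Poly_Mapping.lookup x \<gamma>) * f \<gamma>)"
    if "x \<in> {g, h, g + h}" for x
    by (rule lin_ext_superset) (use that Poly_Mapping.keys_add[of g h] in auto)
  thus ?thesis by (simp add: lookup_add distrib_right sum.distrib)
qed

lemma lin_ext_diff: "lin_ext f (g - h) = lin_ext f g - lin_ext f h"
  using lin_ext_add[of f "g - h" h] by simp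

lemma lin_ext_single: "lin_ext f (Poly_Mapping.single \<gamma> n) = of_int n * f \<gamma>"
  by (simp add: lin_ext_def)

lemma lin_ext_1: "lin_ext f 1 = f 0"
  using lin_ext_single[of f 0 1] by simp

lemma lin_ext_elements:
  "lin_ext f (1 + U + U\<^sup>2) = f 0 + f U_mat + f (U_mat + U_mat)"
  "lin_ext f (1 + S) = f 0 + f S_mat"
  "lin_ext f (1 - eps) = f 0 - f eps_mat"
  "lin_ext f (1 + eps) = f 0 + f eps_mat"
  "lin_ext f (1 + Tinv) = f 0 + f (- T_mat)"
  "lin_ext f (T * (1 + eps)) = f T_mat + f (T_mat + eps_mat)"
  "lin_ext f (5 - 3 * U + U * eps) = 5 * f 0 - 3 * f U_mat + f (U_mat + eps_mat)"
  "lin_ext f (Tinv * (5 - 3 * eps + U))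
    = 5 * f (- T_mat) - 3 * f (- T_mat + eps_mat) + f (- T_mat + U_mat)"
  unfolding T_def Tinv_def S_def U_def eps_def power2_eq_square
    distrib_left right_diff_distrib lin_ext_add lin_ext_diff lin_ext_1 mult_1_right mult_single
    single_numeral[symmetric] lin_ext_single
  by simp_all

text \<open>Well-definedness: equality of fractions is a cross-multiplied equation, which the ring
  homomorphism given by \<open>\<gamma>\<close> preserves, and regular denominators stay
  regular.\<close>

lemma fslash_mat_tfrac:
  assumes "regular D"
  shows "fslash_mat (tfrac N D) \<gamma> = tfrac (slash_mat N \<gamma>) (slash_mat D \<gamma>)"
  unfolding fslash_mat_def
proof (rule the_equality)
  show "\<exists>N' D'. regular D' \<and> tfrac N D = tfrac N' D' \<and>
      tfrac (slash_mat N \<gamma>) (slash_mat D \<gamma>) = tfrac (slash_mat N' \<gamma>) (slash_mat D' \<gamma>)"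
    using assms by blast
next
  fix Q assume "\<exists>N' D'. regular D' \<and> tfrac N D = tfrac N' D' \<and> Q = tfrac (slash_mat N' \<gamma>) (slash_mat D' \<gamma>)"
  then obtain N' D' where *: "regular D'" "tfrac N D = tfrac N' D'"
    and Q: "Q = tfrac (slash_mat N' \<gamma>) (slash_mat D' \<gamma>)" by blast
  have "N * D' = N' * D" using * assms by (simp add: tfrac_eq_iff)
  hence "slash_mat N \<gamma> * slash_mat D' \<gamma> = slash_mat N' \<gamma> * slash_mat D \<gamma>"
    by (metis slash_mat_mult)
  thus "Q = tfrac (slash_mat N \<gamma>) (slash_mat D \<gamma>)"
    unfolding Q using * assms by (simp add: tfrac_eq_iff regular_slash_mat)
qed

lemma fslash_mat_add: "fslash_mat (Q + R) \<gamma> = fslash_mat Q \<gamma> + fslash_mat R \<gamma>"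
  and fslash_mat_mult: "fslash_mat (Q * R) \<gamma> = fslash_mat Q \<gamma> * fslash_mat R \<gamma>"
proof -
  obtain a b c d where "regular b" "Q = tfrac a b" "regular d" "R = tfrac c d"
    by (metis total_fract_cases)
  thus "fslash_mat (Q + R) \<gamma> = fslash_mat Q \<gamma> + fslash_mat R \<gamma>"
    and "fslash_mat (Q * R) \<gamma> = fslash_mat Q \<gamma> * fslash_mat R \<gamma>"
    by (simp_all add: fslash_mat_tfrac tfrac_add tfrac_mult regular_mult regular_slash_mat
        slash_mat_add slash_mat_mult)
qed

lemma fslash_mat_fslash_mat: "fslash_mat (fslash_mat Q \<gamma>) \<delta> = fslash_mat Q (\<gamma> + \<delta>)"
proof -
  obtain a b where "regular b" "Q = tfrac a b"
    by (metis total_fract_cases)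
  thus ?thesis by (simp add: fslash_mat_tfrac regular_slash_mat slash_mat_slash_mat)
qed

lemma fslash_mat_zero: "fslash_mat Q 0 = Q"
proof -
  obtain a b where "regular b" "Q = tfrac a b"
    by (metis total_fract_cases)
  thus ?thesis by (simp add: fslash_mat_tfrac slash_mat_zero)
qed

lemma fslash_mat_0: "fslash_mat 0 \<gamma> = 0"
  and fslash_mat_1: "fslash_mat 1 \<gamma> = 1"
  by (simp_all add: tfrac_zero tfrac_one fslash_mat_tfrac slash_mat_0 slash_mat_1)

lemma fslash_mat_uminus: "fslash_mat (- Q) \<gamma> = - fslash_mat Q \<gamma>"
proof -
  have "fslash_mat (- Q) \<gamma> + fslash_mat Q \<gamma> = 0"
    by (simp flip: fslash_mat_add add: fslash_mat_0)
  thus ?thesis by (simp add: eq_neg_iff_add_eq_0)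
qed

lemma fslash_mat_diff: "fslash_mat (Q - R) \<gamma> = fslash_mat Q \<gamma> - fslash_mat R \<gamma>"
  using fslash_mat_add[of Q "- R"] by (simp add: fslash_mat_uminus)

lemma fslash_mat_numeral: "fslash_mat (numeral n) \<gamma> = numeral n"
  by (induction n) (simp_all only: numeral.simps fslash_mat_add fslash_mat_1)

section \<open>Words in the generators and the relations of \<open>W_plus\<close>\<close>

lemma GL2Z_eqs:
  "- T_mat = S_mat + (S_mat + (S_mat + (U_mat + U_mat)))"
  "U_mat + (U_mat + eps_mat) = eps_mat + (S_mat + (S_mat + U_mat))"
  "T_mat = S_mat + (S_mat + (U_mat + S_mat))"
  "T_mat + eps_mat = eps_mat + (S_mat + (S_mat + (U_mat + (U_mat + S_mat))))"
  by (rule minus_unique | (transfer, simp add: mat2_mult mat2_one))+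

context
  fixes R :: "'a :: comm_ring_1 ps4 total_fract"
  assumes W: "R \<in> W_plus"
begin

lemma W_plus_S: "fslash_mat R S_mat = - R"
  and W_plus_eps: "fslash_mat R eps_mat = R"
  and W_plus_U: "R + fslash_mat R U_mat + fslash_mat R (U_mat + U_mat) = 0"
proof -
  have *: "R + fslash_mat R S_mat = 0" "R - fslash_mat R eps_mat = 0"
    "R + fslash_mat R U_mat + fslash_mat R (U_mat + U_mat) = 0"
    using W by (simp_all add: W_plus_def fslash_eq_lin_ext lin_ext_elements fslash_mat_zero)
  show "R + fslash_mat R U_mat + fslash_mat R (U_mat + U_mat) = 0" by (fact *)
  show "fslash_mat R S_mat = - R" "fslash_mat R eps_mat = R"
    using *(1,2) by (simp_all add: eq_neg_iff_add_eq_0 add.commute)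
qed

text \<open>Letters at the front of a word act first, S by the sign -1 and \<epsilon> trivially, so
  S^2 = -1 acts trivially too. The words in \<open>GL2Z_eqs\<close> are nested to the right so that
  these letters can be stripped off one by one.\<close>

lemma W_plus_S_S: "fslash_mat R (S_mat + (S_mat + \<gamma>)) = fslash_mat R \<gamma>"
  and W_plus_eps_add: "fslash_mat R (eps_mat + \<gamma>) = fslash_mat R \<gamma>"
  and W_plus_S_add: "fslash_mat R (S_mat + \<gamma>) = - fslash_mat R \<gamma>"
  by (simp_all add: W_plus_S W_plus_eps fslash_mat_uminus flip: fslash_mat_fslash_mat)

text \<open>Stripping gives R | T^-1 = - R | U^2 = R + R | U and R | T^-1 \<epsilon> = - R | U. The
  terms R | U cancel and three copies of R remain.\<close>

lemma W_plus_T_inv_sum: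
  "R + fslash_mat R (- T_mat) + fslash_mat (R + fslash_mat R (- T_mat)) eps_mat = 3 * R"
proof -
  have UU: "fslash_mat R (U_mat + U_mat) = - (R + fslash_mat R U_mat)"
    unfolding eq_neg_iff_add_eq_0 using W_plus_U by (simp only: add.commute)
  have "fslash_mat R (- T_mat) = - fslash_mat R (U_mat + U_mat)"
    unfolding GL2Z_eqs(1) by (simp only: W_plus_S_S W_plus_S_add minus_minus)
  moreover have "fslash_mat R (- T_mat + eps_mat) = - fslash_mat R U_mat"
    unfolding GL2Z_eqs(1) add.assoc GL2Z_eqs(2)
    by (simp only: W_plus_S_S W_plus_S_add W_plus_eps_add minus_minus)
  ultimately show ?thesis
    unfolding fslash_mat_add fslash_mat_fslash_mat W_plus_eps using UU by simp
qed

text \<open>Acting with S on the relation for U gives R | US + R | U^2 S = - R | S = R; the two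
  terms on the left are R | T and R | T \<epsilon>.\<close>

lemma W_plus_T_sum: "fslash_mat R T_mat + fslash_mat R (T_mat + eps_mat) = R"
proof -
  have "fslash_mat (R + fslash_mat R U_mat + fslash_mat R (U_mat + U_mat)) S_mat = 0"
    by (simp add: W_plus_U fslash_mat_0)
  hence "fslash_mat R (U_mat + S_mat) + fslash_mat R (U_mat + (U_mat + S_mat)) = R"
    by (simp add: fslash_mat_add fslash_mat_fslash_mat W_plus_S add.assoc diff_eq_eq)
  moreover have "fslash_mat R T_mat = fslash_mat R (U_mat + S_mat)"
    unfolding GL2Z_eqs(3) by (rule W_plus_S_S)
  moreover have "fslash_mat R (T_mat + eps_mat) = fslash_mat R (U_mat + (U_mat + S_mat))"
    unfolding GL2Z_eqs(4) by (simp only: W_plus_eps_add W_plus_S_S)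
  ultimately show ?thesis by simp
qed

end

section \<open>Power series inside their ring of fractions\<close>

lemma tfrac_1_hom:
  fixes F G :: "'a :: comm_ring_1"
  shows "tfrac (F + G) 1 = tfrac F 1 + tfrac G 1"
  "tfrac (F * G) 1 = tfrac F 1 * tfrac G 1"
  "tfrac (- F) 1 = - tfrac F 1"
  "tfrac (F - G) 1 = tfrac F 1 - tfrac G 1"
  "tfrac (numeral n :: 'a) 1 = numeral n"
proof -
  show add: "tfrac (F + G) 1 = tfrac F 1 + tfrac G 1"
    and "tfrac (F * G) 1 = tfrac F 1 * tfrac G 1" for F G :: 'a
    by (simp_all add: tfrac_add tfrac_mult)
  show m: "tfrac (- F) 1 = - tfrac F 1" for F :: 'a
    by (simp add: tfrac_uminus)
  show "tfrac (F - G) 1 = tfrac F 1 - tfrac G 1"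
    using add[of F "- G"] by (simp add: m)
  show "tfrac (numeral n :: 'a) 1 = numeral n"
    by (induction n) (simp_all only: numeral.simps add flip: tfrac_one)
qed

lemma tfrac_1_inject: "tfrac F 1 = tfrac G 1 \<longleftrightarrow> F = G"
  by (simp add: tfrac_eq_iff)

lemma tfrac_scaleQ: "tfrac (c *\<^sub>Q F) 1 = c *\<^sub>Q tfrac F 1"
  for F :: "'a :: rat_algebra"
  using mult_scaleQ_left[of c 1 F] by (simp add: scaleQ_total_fract_def tfrac_mult)

lemma tfrac_eqI: "regular b \<Longrightarrow> b * c = a \<Longrightarrow> tfrac c 1 = tfrac 1 b * tfrac a 1"
  by (simp add: tfrac_mult tfrac_eq_iff mult.commute)

section \<open>The two equations\<close>

lemma scaleQ_numeral: "numeral n *\<^sub>Q x = numeral n * x"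
  for x :: "'a :: rat_algebra"
  by (induction n) (simp_all only: numeral.simps scaleQ_add_left scaleQ_one distrib_right mult_1_left)

lemma scaleQ_zero_left: "0 *\<^sub>Q x = 0"
  using scaleQ_add_left[of 0 0 x] by simp

lemma scaleQ_minus_one: "(- 1) *\<^sub>Q x = - x"
  using scaleQ_add_left[of "- 1" 1 x] by (simp add: scaleQ_zero_left scaleQ_one eq_neg_iff_add_eq_0)

lemma numeral_mult_scaleQ: "numeral n * (c *\<^sub>Q x) = (numeral n * c) *\<^sub>Q x"
  for x :: "'a :: rat_algebra"
  by (simp add: scaleQ_scaleQ flip: scaleQ_numeral)

text \<open>Positive integers are invertible in a rational algebra. This allows both equations to be
  checked after multiplication by 12.\<close>

lemma numeral_mult_cancel:
  fixes x y :: "'a :: rat_algebra"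
  assumes "numeral n * x = numeral n * y"
  shows "x = y"
proof -
  have "(1 / numeral n) *\<^sub>Q (numeral n * x) = (1 / numeral n) *\<^sub>Q (numeral n * y)"
    using assms by simp
  thus ?thesis by (simp add: scaleQ_scaleQ scaleQ_one flip: scaleQ_numeral)
qed

lemma regular_uminus: "regular D \<Longrightarrow> regular (- D)"
  by (simp add: regular_def)

lemma tfrac_1_uminus: "regular D \<Longrightarrow> tfrac 1 (- D) = - tfrac 1 D"
  by (simp add: tfrac_uminus tfrac_eq_iff regular_uminus)

text \<open>Oddness is assumed for the variables X1, Y1; the substitution of f and g for them
  transfers it to all series without constant term.\<close>

lemma subst2_odd:
  fixes F :: "'a :: comm_ring_1 ps2"
  assumes "subst2 F (- X1) (- Y1) = - subst2 F X1 Y1" "ord4_ge 1 f" "ord4_ge 1 g"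
  shows "subst2 F (- f) (- g) = - subst2 F f g"
proof -
  interpret subst_point f 0 g 0 using assms by unfold_locales simp_all
  have "subst (subst2 F (- X1) (- Y1)) = subst (- subst2 F X1 Y1)"
    using assms by simp
  thus ?thesis
    by (simp only: subst_uminus subst4_subst2[OF _ _ f1 f2 g1 g2] ord4_ge_uminus ord4_ge_vars
        subst_X1 subst_Y1)
qed

text \<open>The computation takes place in the ring of fractions with denominators cleared. Inverses
  of linear forms and values of B at pairs of linear forms are named and then treated as independent
  symbols, on which the group elements act by tables.\<close>

lemma double_eisenstein_equations:
  fixes B :: "'a :: rat_algebra ps2"
    and P B2 :: "'a ps4"
  assumes W: "W \<in> W_plus"
    and W_eq: "W = (- 1 / 2) *\<^sub>Q
          ((tfrac 1 X2 + tfrac 1 Y2) * tfrac (subst2 B X1 Y1) 1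
         + (tfrac 1 X1 + tfrac 1 Y1) * tfrac (subst2 B X2 Y2) 1)
        + tfrac P 1"
    and odd: "subst2 B (- X1) (- Y1) = - subst2 B X1 Y1"
    and B2: "B2 = (1 / 3) *\<^sub>Q (P \<bar>\<^sub>s (1 + Tinv))
          - (1 / 12) *\<^sub>Q (R_stuffle B \<bar>\<^sub>s (5 - 3 * U + U * eps))
          - (1 / 12) *\<^sub>Q (R_shuffle B \<bar>\<^sub>s (Tinv * (5 - 3 * eps + U)))"
  shows "P = B2 \<bar>\<^sub>s (1 + eps) + R_stuffle B" "P = B2 \<bar>\<^sub>s (T * (1 + eps)) + R_shuffle B"
proof -
  define b where "b f g = tfrac (subst2 B f g) 1" for f g
  define u1 u2 v1 v2 where "u1 = tfrac 1 (X1 :: 'a ps4)" "u2 = tfrac 1 (X2 :: 'a ps4)"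
    "v1 = tfrac 1 (Y1 :: 'a ps4)" "v2 = tfrac 1 (Y2 :: 'a ps4)"
  note inv_def = this
  define um up vm vp where "um = tfrac 1 (X1 - X2 :: 'a ps4)" "up = tfrac 1 (X1 + X2 :: 'a ps4)"
    "vm = tfrac 1 (Y1 - Y2 :: 'a ps4)" "vp = tfrac 1 (Y1 + Y2 :: 'a ps4)"
  note inv_def = inv_def this
  \<comment> \<open>The ten values of B that occur. A prime marks the image under \<epsilon>, up to
    a sign in the case of e.\<close>
  define a a' c c' where "a = b X1 Y1" "a' = b X2 Y2" "c = b X1 (Y1 + Y2)" "c' = b X2 (Y1 + Y2)"
  note b_vals = this
  \<comment> \<open>The argument - Y2 makes e' the image of a under U; oddness of B then gives e |
    \<epsilon> = - e'.\<close>
  define e e' f f' where "e = b (X1 - X2) Y1" "e' = b (X1 - X2) (- Y2)"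
    "f = b (X1 + X2) Y1" "f' = b (X1 + X2) Y2"
  note b_vals = b_vals this
  define g g' where "g = b X2 (Y2 - Y1)" "g' = b X1 (Y1 - Y2)"
  note b_vals = b_vals this
  note ord = ord4_ge_vars ord4_ge_add ord4_ge_diff ord4_ge_uminus
  note slash_simps = slash_mat_add slash_mat_diff slash_mat_uminus
    slash_mat_T_mat slash_mat_T_mat_inv slash_mat_U_mat slash_mat_eps_mat
  note reg = regular_X1 regular_X2 regular_Y1 regular_Y2 regular_X1_diff_X2 regular_Y1_diff_Y2
    regular_X1_add_X2 regular_Y1_add_Y2
  have b_slash: "fslash_mat (b f g) \<gamma> = b (slash_mat f \<gamma>) (slash_mat g \<gamma>)"
    if "ord4_ge 1 f" "ord4_ge 1 g" for f g \<gamma>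
    using that by (simp add: b_def fslash_mat_tfrac slash_mat_1 slash_mat_subst2)
  have b_odd: "b (- f) (- g) = - b f g" if "ord4_ge 1 f" "ord4_ge 1 g" for f g
    unfolding b_def subst2_odd[OF odd that] by (simp add: tfrac_uminus)
  have inv_slash: "fslash_mat (tfrac 1 D) \<gamma> = tfrac 1 (slash_mat D \<gamma>)" if "regular D"
    for D :: "'a ps4" and \<gamma>
    using that by (simp add: fslash_mat_tfrac slash_mat_1)
  have u_odd: "tfrac 1 (- X2) = - u2" "tfrac 1 (- Y2) = - v2"
    "tfrac 1 (X2 - X1) = - um" "tfrac 1 (Y2 - Y1) = - vm"
    using reg[THEN tfrac_1_uminus] by (simp_all add: inv_def)
  \<comment> \<open>Tables of the action on the symbols. The signs come from reversed differences
    and from the oddness of B.\<close>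
  have inv_eps: "fslash_mat u1 eps_mat = u2" "fslash_mat u2 eps_mat = u1"
    "fslash_mat v1 eps_mat = v2" "fslash_mat v2 eps_mat = v1" "fslash_mat um eps_mat = - um"
    "fslash_mat up eps_mat = up" "fslash_mat vm eps_mat = - vm" "fslash_mat vp eps_mat = vp"
    and inv_T: "fslash_mat u1 T_mat = up" "fslash_mat u2 T_mat = u2" "fslash_mat v1 T_mat = v1"
    "fslash_mat v2 T_mat = - vm" "fslash_mat um T_mat = u1" "fslash_mat vp T_mat = v2"
    and inv_T_inv: "fslash_mat u1 (- T_mat) = um" "fslash_mat u2 (- T_mat) = u2"
    "fslash_mat v1 (- T_mat) = v1" "fslash_mat v2 (- T_mat) = vp" "fslash_mat vm (- T_mat) = - v2"
    and inv_U: "fslash_mat um U_mat = - u2" "fslash_mat v2 U_mat = vp"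
    by (simp_all add: inv_def inv_slash reg slash_simps u_odd[unfolded inv_def] add.commute)
  have b_eps: "fslash_mat a eps_mat = a'" "fslash_mat a' eps_mat = a"
    "fslash_mat c eps_mat = c'" "fslash_mat c' eps_mat = c"
    "fslash_mat e eps_mat = - e'" "fslash_mat e' eps_mat = - e"
    "fslash_mat f eps_mat = f'" "fslash_mat f' eps_mat = f"
    "fslash_mat g eps_mat = g'" "fslash_mat g' eps_mat = g"
    and b_T: "fslash_mat a T_mat = f" "fslash_mat a' T_mat = g" "fslash_mat c T_mat = f'"
    "fslash_mat c' T_mat = a'" "fslash_mat e T_mat = a" "fslash_mat e' T_mat = g'"
    and b_T_inv: "fslash_mat a (- T_mat) = e" "fslash_mat a' (- T_mat) = c'"
    "fslash_mat f (- T_mat) = a" "fslash_mat f' (- T_mat) = c"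
    and b_U: "fslash_mat a U_mat = e'" "fslash_mat c U_mat = e" "fslash_mat c' U_mat = a"
    using b_odd[of "X1 - X2" "- Y2"] b_odd[of "X1 - X2" Y1]
    by (simp_all add: b_vals b_slash ord slash_simps ord[unfolded One_nat_def] add.commute)
  define p w s t where "p = tfrac P 1" "w = W" "s = tfrac (R_stuffle B) 1" "t = tfrac (R_shuffle B) 1"
  note defs = this
  note hom = fslash_mat_add fslash_mat_diff fslash_mat_mult fslash_mat_uminus fslash_mat_numeral
  have s: "s = um * (c - c')"
    unfolding defs inv_def b_vals b_def tfrac_1_hom(4)[symmetric]
    by (rule tfrac_eqI[OF regular_X1_diff_X2 R_stuffle])
  have t: "t = vm * (f - f')"
    unfolding defs inv_def b_vals b_def tfrac_1_hom(4)[symmetric]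
    by (rule tfrac_eqI[OF regular_Y1_diff_Y2 R_shuffle])
  \<comment> \<open>The assumed form of W solved for P, doubled to remove the factor 1/2.\<close>
  have p: "2 * p = 2 * w + (u2 + v2) * a + (u1 + v1) * a'"
    unfolding defs W_eq distrib_left[of 2] numeral_mult_scaleQ
    by (simp add: scaleQ_minus_one b_vals b_def inv_def scaleQ_one)
  \<comment> \<open>X is what remains of 12 B2 besides 4 W | (1 + T^-1): four terms from the polar
    part of P, three from \<open>R_stuffle\<close> and three from \<open>R_shuffle\<close>.\<close>
  define X where "X = 2 * (u2 + v2) * a + 2 * (u1 + v1) * a' + 2 * (u2 + vp) * e + 2 * (um + v1) * c'
    - 5 * um * (c - c') - 3 * u2 * (e - a) - u1 * (e' + a') + 5 * v2 * (a - c) - 3 * v1 * (a' - c')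
    + vp * (e' - e)"
  have "12 * tfrac B2 1 = 4 * (p + fslash_mat p (- T_mat))
      - (5 * s - 3 * fslash_mat s U_mat + fslash_mat (fslash_mat s U_mat) eps_mat)
      - (5 * fslash_mat t (- T_mat) - 3 * fslash_mat (fslash_mat t (- T_mat)) eps_mat
          + fslash_mat (fslash_mat t (- T_mat)) U_mat)"
    unfolding B2 slash_eq_lin_ext lin_ext_elements tfrac_1_hom tfrac_scaleQ
      right_diff_distrib[of 12] numeral_mult_scaleQ
    by (simp add: scaleQ_numeral scaleQ_one fslash_mat_fslash_mat fslash_mat_tfrac slash_mat_1
        slash_mat_zero slash_mat_slash_mat tfrac_1_hom defs)
  also have "4 * (p + fslash_mat p (- T_mat)) = 2 * (2 * p + fslash_mat (2 * p) (- T_mat))"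
    by (simp add: hom)
  finally have B2: "12 * tfrac B2 1 = 4 * (w + fslash_mat w (- T_mat)) + X"
    unfolding p s t X_def by (simp add: hom inv_T_inv inv_U inv_eps b_T_inv b_U b_eps algebra_simps)
  show "P = B2 \<bar>\<^sub>s (1 + eps) + R_stuffle B"
  proof -
    have "12 * tfrac (B2 \<bar>\<^sub>s (1 + eps) + R_stuffle B) 1
      = 12 * tfrac B2 1 + fslash_mat (12 * tfrac B2 1) eps_mat + 12 * s"
      unfolding slash_eq_lin_ext lin_ext_elements tfrac_1_hom
      by (simp add: hom fslash_mat_tfrac slash_mat_1 slash_mat_zero defs algebra_simps)
    also have "\<dots> = 4 * (w + fslash_mat w (- T_mat) + fslash_mat (w + fslash_mat w (- T_mat)) eps_mat)
      + X + fslash_mat X eps_mat + 12 * s"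
      unfolding B2 by (simp add: hom algebra_simps)
    also have "\<dots> = 6 * (2 * w) + X + fslash_mat X eps_mat + 12 * s"
      unfolding defs W_plus_T_inv_sum[OF W] by simp
    \<comment> \<open>X | (1 + \<epsilon>) + 12 s collapses to six times (u2 + v2) a + (u1 + v1) a',
      the polar part that separates 2 p from 2 w.\<close>
    also have "\<dots> = 6 * (2 * p)"
      unfolding p X_def s by (simp add: hom inv_eps b_eps algebra_simps)
    also have "\<dots> = 12 * p" by simp
    finally have "tfrac (B2 \<bar>\<^sub>s (1 + eps) + R_stuffle B) 1 = p"
      by (rule numeral_mult_cancel)
    thus ?thesis by (simp add: defs tfrac_1_inject)
  qed
  show "P = B2 \<bar>\<^sub>s (T * (1 + eps)) + R_shuffle B"
  proof -
    have "12 * tfrac (B2 \<bar>\<^sub>s (T * (1 + eps)) + R_shuffle B) 1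
      = fslash_mat (12 * tfrac B2 1) T_mat + fslash_mat (fslash_mat (12 * tfrac B2 1) T_mat) eps_mat + 12 * t"
      unfolding slash_eq_lin_ext lin_ext_elements tfrac_1_hom fslash_mat_fslash_mat
      by (simp add: hom fslash_mat_tfrac slash_mat_1 slash_mat_zero defs algebra_simps)
    \<comment> \<open>Acting with T on w | (1 + T^-1) gives w | T + w; applying 1 + \<epsilon> then
      produces the four terms in w, which add up to 3 w by the relations of
      \<open>W_plus\<close>.\<close>
    also have "\<dots> = 4 * (w + fslash_mat w eps_mat + (fslash_mat w T_mat + fslash_mat w (T_mat + eps_mat)))
      + fslash_mat X T_mat + fslash_mat (fslash_mat X T_mat) eps_mat + 12 * t"
      unfolding B2 by (simp add: hom fslash_mat_fslash_mat fslash_mat_zero algebra_simps)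
    also have "\<dots> = 6 * (2 * w) + fslash_mat X T_mat + fslash_mat (fslash_mat X T_mat) eps_mat + 12 * t"
      unfolding defs W_plus_T_sum[OF W] W_plus_eps[OF W] by simp
    \<comment> \<open>X | T (1 + \<epsilon>) + 12 t collapses to the same multiple of the polar part
      as in the first equation.\<close>
    also have "\<dots> = 6 * (2 * p)"
      unfolding p X_def t by (simp add: hom inv_T inv_eps b_T b_eps algebra_simps)
    also have "\<dots> = 12 * p" by simp
    finally have "tfrac (B2 \<bar>\<^sub>s (T * (1 + eps)) + R_shuffle B) 1 = p"
      by (rule numeral_mult_cancel)
    thus ?thesis by (simp add: defs tfrac_1_inject)
  qed
qed

section \<open>Realizations of the formal double Eisenstein space\<close>

definition map_ps2 :: "('a \<Rightarrow> 'b) \<Rightarrow> 'a ps2 \<Rightarrow> 'b ps2"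
  where "map_ps2 h F = mk_ps2 (\<lambda>i j. h (coeff2 F i j))"

definition map_ps4 :: "('a \<Rightarrow> 'b) \<Rightarrow> 'a ps4 \<Rightarrow> 'b ps4"
  where "map_ps4 h F = mk_ps4 (\<lambda>i j k l. h (coeff4 F i j k l))"

lemma coeff2_map_ps2 [simp]: "coeff2 (map_ps2 h F) i j = h (coeff2 F i j)"
  by (simp add: map_ps2_def)

lemma coeff4_map_ps4 [simp]: "coeff4 (map_ps4 h F) i j k l = h (coeff4 F i j k l)"
  by (simp add: map_ps4_def)

text \<open>Series with integer coefficients, read over any ring: a coefficientwise additive map
  commutes with multiplication by them.\<close>

abbreviation of_int4 :: "int ps4 \<Rightarrow> 'a :: comm_ring_1 ps4"
  where "of_int4 \<equiv> map_ps4 of_int"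

lemma of_int4_hom:
  "of_int4 (F + G) = of_int4 F + of_int4 G"
  "of_int4 (F - G) = of_int4 F - of_int4 G"
  "of_int4 (- F) = - of_int4 F"
  "of_int4 (F * G) = of_int4 F * of_int4 G"
  "of_int4 1 = 1"
  by (rule ps4_eqI, simp add: coeff4_add coeff4_diff coeff4_uminus coeff4_mult coeff4_one)+

lemma of_int4_power: "of_int4 (F ^ n) = of_int4 F ^ n"
  by (induction n) (simp_all add: of_int4_hom)

lemma coeff4_of_int: "coeff4 (of_int n :: 'a :: comm_ring_1 ps4) i j k l
    = (if i = 0 \<and> j = 0 \<and> k = 0 \<and> l = 0 then of_int n else 0)"
  using coeff4_const_mult[of "of_int n :: 'a" 1 i j k l] by (simp add: const4_of_int coeff4_one)

lemma of_int4_of_int: "of_int4 (of_int n) = of_int n"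
  by (rule ps4_eqI) (simp add: coeff4_of_int)

lemma of_int4_vars: "of_int4 X1 = X1" "of_int4 X2 = X2" "of_int4 Y1 = Y1" "of_int4 Y2 = Y2"
proof -
  have "of_int4 (monom4 p q r s) = monom4 p q r s" for p q r s
    by (rule ps4_eqI) (simp add: coeff4_monom4)
  from this[of 1 0 0 0] this[of 0 1 0 0] this[of 0 0 1 0] this[of 0 0 0 1]
  show "of_int4 X1 = X1" "of_int4 X2 = X2" "of_int4 Y1 = Y1" "of_int4 Y2 = Y2"
    by (simp_all add: monom4_def)
qed

text \<open>Multiplicativity is not demanded, because the evaluation of symbols used below is
  meaningful only on linear forms.\<close>

locale additive_map =
  fixes h :: "'a :: comm_ring_1 \<Rightarrow> 'b :: comm_ring_1"
  assumes add: "h (x + y) = h x + h y"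
begin

lemma zero: "h 0 = 0"
  using add[of 0 0] by simp

lemma uminus: "h (- x) = - h x"
  using add[of "- x" x] by (simp add: zero eq_neg_iff_add_eq_0)

lemma diff: "h (x - y) = h x - h y"
  using add[of x "- y"] by (simp add: uminus)

lemma sum: "h (\<Sum>x\<in>A. f x) = (\<Sum>x\<in>A. h (f x))"
  by (induction A rule: infinite_finite_induct) (simp_all add: zero add)

lemma mult_of_int: "h (x * of_int n) = h x * of_int n"
proof -
  have nat: "h (x * of_nat m) = h x * of_nat m" for m
    by (induction m) (simp_all add: zero add distrib_left)
  show ?thesis by (cases n) (simp_all add: nat uminus flip: of_nat_Suc)
qed

lemma mult_of_int': "h (of_int n * x) = of_int n * h x"
  using mult_of_int[of x n] by (simp only: mult.commute)

lemma map_ps4_add: "map_ps4 h (F + G) = map_ps4 h F + map_ps4 h G"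
  and map_ps4_diff: "map_ps4 h (F - G) = map_ps4 h F - map_ps4 h G"
  and map_ps4_mult: "map_ps4 h (of_int4 Z * F) = of_int4 Z * map_ps4 h F"
  and map_ps4_sum: "map_ps4 h (\<Sum>x\<in>A. f x) = (\<Sum>x\<in>A. map_ps4 h (f x))"
  by (rule ps4_eqI, simp add: coeff4_add coeff4_diff coeff4_mult coeff4_sum add diff sum mult_of_int')+

text \<open>A coefficient of the substituted series is a finite combination of coefficients of F,
  with coefficients of power products of integral series as integer weights.\<close>

lemma map_ps4_subst4: "map_ps4 h (subst4 F (of_int4 f1) (of_int4 f2) (of_int4 g1) (of_int4 g2))
    = subst4 (map_ps4 h F) (of_int4 f1) (of_int4 f2) (of_int4 g1) (of_int4 g2)"
  by (rule ps4_eqI)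
    (simp add: subst4_def Let_def sum mult_of_int flip: of_int4_hom of_int4_power)

lemma map_ps4_subst2: "map_ps4 h (subst2 F (of_int4 f) (of_int4 g))
    = subst2 (map_ps2 h F) (of_int4 f) (of_int4 g)"
  by (rule ps4_eqI)
    (simp add: subst2_def Let_def sum mult_of_int flip: of_int4_hom of_int4_power)

lemma map_ps4_slash_mat: "map_ps4 h (slash_mat R \<gamma>) = slash_mat (map_ps4 h R) \<gamma>"
proof -
  have v: "of_int4 (slash_x1 \<gamma>) = slash_x1 \<gamma>" "of_int4 (slash_x2 \<gamma>) = slash_x2 \<gamma>"
    "of_int4 (slash_y1 \<gamma>) = slash_y1 \<gamma>" "of_int4 (slash_y2 \<gamma>) = slash_y2 \<gamma>"
    by (simp_all only: slash_vars_def of_int4_hom of_int4_of_int of_int4_vars)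
  show ?thesis
    using map_ps4_subst4[of R "slash_x1 \<gamma>" "slash_x2 \<gamma>" "slash_y1 \<gamma>" "slash_y2 \<gamma>"]
    by (simp only: slash_mat_subst4 v)
qed

lemma map_ps4_slash: "map_ps4 h (R \<bar>\<^sub>s g) = map_ps4 h R \<bar>\<^sub>s g"
proof -
  have "map_ps4 h (of_int n * F) = of_int n * map_ps4 h F" for n F
    using map_ps4_mult[of "of_int n" F] by (simp only: of_int4_of_int)
  thus ?thesis by (simp add: slash_def map_ps4_sum map_ps4_slash_mat)
qed

text \<open>X1 - X2 is integral and regular, so both sides may be compared after multiplication by
  it, where the quotient disappears.\<close>

lemma map_ps4_R_stuffle: "map_ps4 h (R_stuffle F) = R_stuffle (map_ps2 h F)"
proof (rule regular_cancel[OF regular_X1_diff_X2])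
  have "(X1 - X2) * map_ps4 h (R_stuffle F) = map_ps4 h ((X1 - X2) * R_stuffle F)"
    using map_ps4_mult[of "X1 - X2"] by (simp add: of_int4_hom of_int4_vars)
  also have "\<dots> = subst2 (map_ps2 h F) X1 (Y1 + Y2) - subst2 (map_ps2 h F) X2 (Y1 + Y2)"
    using map_ps4_subst2[of F X1 "Y1 + Y2"] map_ps4_subst2[of F X2 "Y1 + Y2"]
    by (simp add: R_stuffle map_ps4_diff of_int4_hom of_int4_vars)
  finally show "(X1 - X2) * map_ps4 h (R_stuffle F) = (X1 - X2) * R_stuffle (map_ps2 h F)"
    by (simp add: R_stuffle)
qed

lemma map_ps4_R_shuffle: "map_ps4 h (R_shuffle F) = R_shuffle (map_ps2 h F)"
proof (rule regular_cancel[OF regular_Y1_diff_Y2])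
  have "(Y1 - Y2) * map_ps4 h (R_shuffle F) = map_ps4 h ((Y1 - Y2) * R_shuffle F)"
    using map_ps4_mult[of "Y1 - Y2"] by (simp add: of_int4_hom of_int4_vars)
  also have "\<dots> = subst2 (map_ps2 h F) (X1 + X2) Y1 - subst2 (map_ps2 h F) (X1 + X2) Y2"
    using map_ps4_subst2[of F "X1 + X2" Y1] map_ps4_subst2[of F "X1 + X2" Y2]
    by (simp add: R_shuffle map_ps4_diff of_int4_hom of_int4_vars)
  finally show "(Y1 - Y2) * map_ps4 h (R_shuffle F) = (Y1 - Y2) * R_shuffle (map_ps2 h F)"
    by (simp add: R_shuffle)
qed

end

section \<open>Evaluation of symbols and descent to the quotient\<close>

interpretation rat_alg: module "scaleQ :: rat \<Rightarrow> 'a :: rat_algebra \<Rightarrow> 'a"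
  by unfold_locales (simp_all add: scaleQ_add_left scaleQ_add_right scaleQ_scaleQ scaleQ_one)

text \<open>Only the values on linear forms matter; the values on other monomials are arbitrary.\<close>

definition eis_eval :: "(eis_symbol \<Rightarrow> 'a :: rat_algebra) \<Rightarrow> eis_poly \<Rightarrow> 'a"
  where "eis_eval v x = (\<Sum>m\<in>Poly_Mapping.keys x. Poly_Mapping.lookup x m *\<^sub>Q (\<Sum>s\<in>Poly_Mapping.keys m. v s))"

lemma eis_eval_superset:
  assumes "finite A" "Poly_Mapping.keys x \<subseteq> A"
  shows "eis_eval v x = (\<Sum>m\<in>A. Poly_Mapping.lookup x m *\<^sub>Q (\<Sum>s\<in>Poly_Mapping.keys m. v s))"
  unfolding eis_eval_def
  by (rule sum.mono_neutral_left) (use assms in \<open>auto simp: in_keys_iff scaleQ_zero_left\<close>)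

lemma eis_eval_add: "eis_eval v (x + y) = eis_eval v x + eis_eval v y"
proof -
  have "eis_eval v z = (\<Sum>m\<in>Poly_Mapping.keys x \<union> Poly_Mapping.keys y.
      Poly_Mapping.lookup z m *\<^sub>Q (\<Sum>s\<in>Poly_Mapping.keys m. v s))" if "z \<in> {x, y, x + y}" for z
    by (rule eis_eval_superset) (use that Poly_Mapping.keys_add[of x y] in auto)
  thus ?thesis by (simp add: lookup_add scaleQ_add_left sum.distrib)
qed

lemma eis_eval_scale: "eis_eval v (c *\<^sub>Q x) = c *\<^sub>Q eis_eval v x"
proof -
  have l: "Poly_Mapping.lookup (c *\<^sub>Q x) m = c * Poly_Mapping.lookup x m" for m
    by (simp add: scaleQ_poly_mapping_def scaleQ_rat_def Poly_Mapping.map.rep_eq when_def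
        flip: mult_map_scale_conv_mult)
  hence "Poly_Mapping.keys (c *\<^sub>Q x) \<subseteq> Poly_Mapping.keys x" by (auto simp: in_keys_iff)
  hence "eis_eval v (c *\<^sub>Q x) = (\<Sum>m\<in>Poly_Mapping.keys x.
      Poly_Mapping.lookup (c *\<^sub>Q x) m *\<^sub>Q (\<Sum>s\<in>Poly_Mapping.keys m. v s))"
    by (intro eis_eval_superset) simp_all
  thus ?thesis by (simp only: l eis_eval_def rat_alg.scale_sum_right scaleQ_scaleQ)
qed

lemma eis_eval_sym: "eis_eval v (eis_sym s) = v s"
  by (simp add: eis_eval_def eis_sym_def scaleQ_one)

text \<open>The evaluation vanishes on the relations, so it is constant on cosets and descends to
  them.\<close>

lemma realization_of_relations:
  fixes v :: "eis_symbol \<Rightarrow> 'a :: rat_algebra"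
  assumes rel: "\<And>r. r \<in> eis_relations K \<Longrightarrow> eis_eval v r = 0"
  shows "\<exists>\<phi>. realization K \<phi> \<and> (\<forall>x. \<phi> (eis_class K x) = eis_eval v x)"
proof -
  \<comment> \<open>Any representative will do. The value of \<open>\<phi>\<close> is therefore
    found by showing that all elements of a nonempty set evaluate alike, which also settles sums and
    multiples of cosets.\<close>
  define \<phi> where "\<phi> u = eis_eval v (SOME x. x \<in> u)" for u
  have 0: "0 \<in> eis_relations K"
    unfolding eis_relations_def by (rule rat_alg.span_zero)
  have \<phi>: "\<phi> u = a" if "u \<noteq> {}" "\<And>x. x \<in> u \<Longrightarrow> eis_eval v x = a" for u a
    unfolding \<phi>_def using that someI_ex[of "\<lambda>x. x \<in> u"] by blast
  have self: "x \<in> eis_class K x" for x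
    unfolding eis_class_def using 0 by force
  have val: "eis_eval v y = eis_eval v x" if "y \<in> eis_class K x" for x y
    using that by (auto simp: eis_class_def eis_eval_add rel)
  have \<phi>_class: "\<phi> (eis_class K x) = eis_eval v x" for x
    using self val by (intro \<phi>) blast+
  have "realization K \<phi>"
    unfolding realization_def
  proof (intro conjI ballI allI)
    fix u u' assume "u \<in> eis_space K" "u' \<in> eis_space K"
    then obtain x x' where [simp]: "u = eis_class K x" "u' = eis_class K x'" by (auto simp: eis_space_def)
    show "\<phi> (eis_add u u') = \<phi> u + \<phi> u'"
      using self by (intro \<phi>) (auto simp: eis_add_def \<phi>_class eis_eval_add val)
  next
    fix c u assume "u \<in> eis_space K"
    then obtain x where [simp]: "u = eis_class K x" by (auto simp: eis_space_def)
    show "\<phi> (eis_scale K c u) = c *\<^sub>Q \<phi> u"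
      using self 0 by (intro \<phi>) (auto simp: eis_scale_def \<phi>_class eis_eval_add eis_eval_scale val rel)
  qed
  thus ?thesis using \<phi>_class by blast
qed

theorem theorem3p3:
  fixes B1 :: "'a :: rat_algebra ps2"
    and PB B2 :: "'a ps4"
    and Ptilde :: "'a ps4 total_fract"
  assumes Ptilde_W: "Ptilde \<in> W_plus"
    and Ptilde_form:
      "Ptilde = (- 1 / 2) *\<^sub>Q
          ((tfrac 1 X2 + tfrac 1 Y2) * tfrac (subst2 B1 X1 Y1) 1
         + (tfrac 1 X1 + tfrac 1 Y1) * tfrac (subst2 B1 X2 Y2) 1)
        + tfrac PB 1"
    and B1_odd: "subst2 B1 (- X1) (- Y1) = - subst2 B1 X1 Y1"
    and B2_eq:
      "B2 = (1 / 3) *\<^sub>Q (PB \<bar>\<^sub>s (1 + Tinv))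
          - (1 / 12) *\<^sub>Q (R_stuffle B1 \<bar>\<^sub>s (5 - 3 * U + U * eps))
          - (1 / 12) *\<^sub>Q (R_shuffle B1 \<bar>\<^sub>s (Tinv * (5 - 3 * eps + U)))"
  shows "PB = B2 \<bar>\<^sub>s (1 + eps) + R_stuffle B1
    \<and> PB = B2 \<bar>\<^sub>s (T * (1 + eps)) + R_shuffle B1
    \<and> (\<forall>K\<ge>1. \<exists>\<phi> :: eis_poly set \<Rightarrow> 'a. realization K \<phi>
        \<and> (\<forall>k d. k \<ge> 1 \<and> k + d = K \<longrightarrow>
              \<phi> (eis_class K (eis_sym (G1s k d))) = fact d *\<^sub>Q coeff2 B1 (k - 1) d)
        \<and> (\<forall>k1 k2 d1 d2. k1 \<ge> 1 \<and> k2 \<ge> 1 \<and> k1 + k2 + d1 + d2 = K \<longrightarrow>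
              \<phi> (eis_class K (eis_sym (G2s k1 k2 d1 d2)))
                = (fact d1 * fact d2) *\<^sub>Q coeff4 B2 (k1 - 1) (k2 - 1) d1 d2
            \<and> \<phi> (eis_class K (eis_sym (P2s k1 k2 d1 d2)))
                = (fact d1 * fact d2) *\<^sub>Q coeff4 PB (k1 - 1) (k2 - 1) d1 d2))"
proof -
  note eqs = double_eisenstein_equations[OF assms]
  \<comment> \<open>The factorials undo the division by d! in the generating series, and k - 1
    undoes their index shift. One assignment serves all weights K.\<close>
  define v where "v s = (case s of
      G1s k d \<Rightarrow> fact d *\<^sub>Q coeff2 B1 (k - 1) d
    | G2s k1 k2 d1 d2 \<Rightarrow> (fact d1 * fact d2) *\<^sub>Q coeff4 B2 (k1 - 1) (k2 - 1) d1 d2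
    | P2s k1 k2 d1 d2 \<Rightarrow> (fact d1 * fact d2) *\<^sub>Q coeff4 PB (k1 - 1) (k2 - 1) d1 d2)" for s
  interpret additive_map "eis_eval v" by unfold_locales (rule eis_eval_add)
  have gen: "map_ps2 (eis_eval v) gen_G1 = B1" "map_ps4 (eis_eval v) gen_G2 = B2"
    "map_ps4 (eis_eval v) gen_P = PB"
    by (simp_all add: fps_eq_iff map_ps2_def map_ps4_def mk_ps2_def mk_ps4_def coeff2_def coeff4_def
        gen_G1_def gen_G2_def gen_P_def eis_eval_scale eis_eval_sym v_def scaleQ_scaleQ scaleQ_one)
  \<comment> \<open>Coefficientwise evaluation turns the two defining relations into the two
    equations already established for B2.\<close>
  have "map_ps4 (eis_eval v) D = 0" if
    "D \<in> {gen_P - (gen_G2 \<bar>\<^sub>s (1 + eps) + R_stuffle gen_G1),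
           gen_P - (gen_G2 \<bar>\<^sub>s (T * (1 + eps)) + R_shuffle gen_G1)}" for D
    using that eqs by (auto simp: map_ps4_diff map_ps4_add map_ps4_slash map_ps4_R_stuffle
        map_ps4_R_shuffle gen)
  hence coeff: "eis_eval v (coeff4 D i j k l) = 0" if
    "D \<in> {gen_P - (gen_G2 \<bar>\<^sub>s (1 + eps) + R_stuffle gen_G1),
           gen_P - (gen_G2 \<bar>\<^sub>s (T * (1 + eps)) + R_shuffle gen_G1)}" for D i j k l
    using that by (metis coeff4_map_ps4 coeff4_zero)
  \<comment> \<open>Linearity extends the vanishing from single coefficients to their rational
    span.\<close>
  have rel: "eis_eval v r = 0" if "r \<in> eis_relations K" for r K
    using that unfolding eis_relations_def
    by (induction rule: rat_alg.span_induct_alt)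
      (use coeff in \<open>auto simp: zero eis_eval_add eis_eval_scale rat_alg.scale_zero_right\<close>)
  show ?thesis
  proof (intro conjI allI impI)
    fix K :: nat
    obtain \<phi> :: "eis_poly set \<Rightarrow> 'a" where "realization K \<phi>" "\<And>x. \<phi> (eis_class K x) = eis_eval v x"
      using realization_of_relations[of K v] rel by blast
    thus "\<exists>\<phi> :: eis_poly set \<Rightarrow> 'a. realization K \<phi>
        \<and> (\<forall>k d. k \<ge> 1 \<and> k + d = K \<longrightarrow>
              \<phi> (eis_class K (eis_sym (G1s k d))) = fact d *\<^sub>Q coeff2 B1 (k - 1) d)
        \<and> (\<forall>k1 k2 d1 d2. k1 \<ge> 1 \<and> k2 \<ge> 1 \<and> k1 + k2 + d1 + d2 = K \<longrightarrow>
              \<phi> (eis_class K (eis_sym (G2s k1 k2 d1 d2)))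
                = (fact d1 * fact d2) *\<^sub>Q coeff4 B2 (k1 - 1) (k2 - 1) d1 d2
            \<and> \<phi> (eis_class K (eis_sym (P2s k1 k2 d1 d2)))
                = (fact d1 * fact d2) *\<^sub>Q coeff4 PB (k1 - 1) (k2 - 1) d1 d2)"
      by (intro exI[of _ \<phi>]) (simp add: eis_eval_sym v_def)
  qed (fact eqs)+
qed

end
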